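(* Let $D\subset\mathbb{C}^2$ be a plane curve and let $f\in\mathfrak{m}^3$ be a reduced local equation for $D$ around $0$. Then, after a possible change of variables (i.e. in some system of local coordinates $(x,y)$ of $\mathbb{C}^2$ centered at $0$), there exists a basis of $\operatorname{Der}_f$ as an $\mathcal{O}$-module such that one of the following two conditions holds: (1) at least one of its elements has zero linear part (and therefore it is topologically nilpotent); (2) the linear parts of its elements are $x\partial_x$ and $(ax+y)\partial_x$ for some $a\in\mathbb{C}$.
   Context: $\mathcal{O}=\mathcal{O}_{\mathbb{C}^2,0}$ is the ring of convergent power series in two variables, $\mathfrak m$ its maximal ideal. "Reduced" means without repeated factors. $\operatorname{Der}_f$ is the $\mathcal{O}$-module of $\mathbb{C}$-derivations $\delta$ of $\mathcal{O}$ with $\delta(f)\in\mathcal{O}f$; it is free of rank $2$ (every plane curve is a free divisor). In coordinates $(x,y)$, the linear part of a derivation $\delta=a\,\partial_x+b\,\partial_y$ is $\delta_0=a_1\partial_x+b_1\partial_y$, where $a_1,b_1$ are the homogeneous components of degree $1$ of $a,b$. A derivation is singular if its coefficients lie in $\mathfrak m$. A singular derivation, extended to $\widehat{\mathcal{O}}$ (the $\mathfrak m$-adic completion of $\mathcal{O}$), is topologically nilpotent if for every $h\in\widehat{\mathcal{O}}$ the sequence $(\delta^m(h))_m$ tends to $0$ in the $\mathfrak m$-adic topology. *)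

theory Defs
  imports
    "HOL-Analysis.Analysis"
    "HOL-Computational_Algebra.Computational_Algebra"
    "HOL-Library.Function_Algebras"
begin

unbundle no vec_syntax
unbundle fps_syntax

section \<open>Formal power series in two variables\<close>

text \<open>
  The type \<^typ>\<open>complex fps fps\<close> is the ring of formal power series in two variables, the
  completion of the ring of convergent ones; \<open>F $ i $ j\<close> is the coefficient of \<open>x\<^sup>i y\<^sup>j\<close>, so
  \<open>x\<close> is the outer and \<open>y\<close> the inner variable.
\<close>

type_synonym formal2 = "complex fps fps"

definition formal_max_ideal :: "formal2 set" where
  "formal_max_ideal = {F. F $ 0 $ 0 = 0}"

definition formal_dx :: "formal2 \<Rightarrow> formal2" where
  "formal_dx F = fps_deriv F"

definition formal_dy :: "formal2 \<Rightarrow> formal2" where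
  "formal_dy F = Abs_fps (\<lambda>i. fps_deriv (F $ i))"

primrec ideal_power :: "'a::comm_ring_1 set \<Rightarrow> nat \<Rightarrow> 'a set" where
  "ideal_power I 0 = UNIV"
| "ideal_power I (Suc n) = module.span (*) {a * b | a b. a \<in> I \<and> b \<in> ideal_power I n}"

lemma module_times: "module ((*) :: 'a::comm_ring_1 \<Rightarrow> 'a \<Rightarrow> 'a)"
  by unfold_locales (simp_all add: algebra_simps)


section \<open>The ring of convergent power series\<close>

definition convergent2 :: "formal2 \<Rightarrow> bool" where
  "convergent2 F \<longleftrightarrow>
     (\<exists>r>0. (\<lambda>(i, j). norm (F $ i $ j) * r ^ (i + j)) summable_on (UNIV :: (nat \<times> nat) set))"

lemma convergent2I_bound:
  assumes "\<And>i j. norm (F $ i $ j) \<le> C * R ^ (i + j)"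
  shows "convergent2 F"
proof -
  have C: "C \<ge> 0" using order_trans[OF norm_ge_zero assms[of 0 0]] by simp
  have b: "norm (F $ i $ j) \<le> C * max \<bar>R\<bar> 1 ^ (i + j)" for i j
  proof -
    have "R ^ (i + j) \<le> \<bar>R\<bar> ^ (i + j)"
      by (metis abs_ge_self power_abs)
    also have "\<dots> \<le> max \<bar>R\<bar> 1 ^ (i + j)"
      by (intro power_mono) auto
    finally show ?thesis
      using assms[of i j] C by (meson mult_left_mono order_trans)
  qed
  define T where "T = max \<bar>R\<bar> 1"
  have T: "T \<ge> 1" by (simp add: T_def)
  define r where "r = 1 / (2 * T)"
  have r: "r > 0" using T by (simp add: r_def)
  define g where "g = (\<lambda>(i, j). norm (F $ i $ j) * r ^ (i + j))"
  have g: "g (i, j) \<le> C * ((1/2) ^ i * (1/2) ^ j)" for i j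
  proof -
    have "g (i, j) \<le> C * T ^ (i + j) * r ^ (i + j)"
      unfolding g_def using b[of i j] r by (auto simp: T_def intro!: mult_right_mono)
    also have "\<dots> = C * (T * r) ^ (i + j)"
      by (simp add: power_mult_distrib)
    also have "T * r = 1/2" using T by (simp add: r_def)
    finally show ?thesis by (simp add: power_add)
  qed
  have geo: "(\<Sum>i\<le>N. (1/2::real) ^ i) \<le> 2" for N
    using sum_le_suminf[OF summable_geometric[of "1/2::real"], of "{..N}"]
    by (simp add: suminf_geometric)
  have "g summable_on UNIV"
  proof (rule nonneg_bdd_above_summable_on)
    show "g p \<ge> 0" for p using r by (auto simp: g_def split: prod.splits)
    show "bdd_above (sum g ` {A. A \<subseteq> UNIV \<and> finite A})"
    proof (rule bdd_aboveI2)
      fix A :: "(nat \<times> nat) set"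
      assume "A \<in> {A. A \<subseteq> UNIV \<and> finite A}"
      then have A: "finite A" by simp
      define N where "N = Max (insert 0 (fst ` A \<union> snd ` A))"
      have "A \<subseteq> {..N} \<times> {..N}"
      proof
        fix p assume "p \<in> A"
        then have "fst p \<le> N" "snd p \<le> N"
          unfolding N_def using A by (auto intro!: Max_ge)
        then show "p \<in> {..N} \<times> {..N}" by (cases p) auto
      qed
      then have "sum g A \<le> sum g ({..N} \<times> {..N})"
        using r by (intro sum_mono2) (auto simp: g_def)
      also have "\<dots> = (\<Sum>i\<le>N. \<Sum>j\<le>N. g (i, j))"
        by (simp add: sum.cartesian_product)
      also have "\<dots> \<le> (\<Sum>i\<le>N. \<Sum>j\<le>N. C * ((1/2) ^ i * (1/2) ^ j))"
        by (intro sum_mono g)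
      also have "\<dots> = C * ((\<Sum>i\<le>N. (1/2) ^ i) * (\<Sum>j\<le>N. (1/2) ^ j))"
        by (subst sum_product) (simp add: sum_distrib_left)
      also have "\<dots> \<le> C * (2 * 2)"
        using C geo by (intro mult_left_mono mult_mono) (auto intro: sum_nonneg)
      finally show "sum g A \<le> C * (2 * 2)" .
    qed
  qed
  then show ?thesis unfolding convergent2_def g_def using r by blast
qed

lemma convergent2_iff_bound:
  "convergent2 F \<longleftrightarrow> (\<exists>C R. \<forall>i j. norm (F $ i $ j) \<le> C * R ^ (i + j))"
proof
  assume "convergent2 F"
  then obtain r where r: "r > 0"
    and s: "(\<lambda>(i, j). norm (F $ i $ j) * r ^ (i + j)) summable_on (UNIV :: (nat \<times> nat) set)"
    by (auto simp: convergent2_def)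
  define g where "g = (\<lambda>(i, j). norm (F $ i $ j) * r ^ (i + j))"
  define C where "C = infsum g UNIV"
  have "norm (F $ i $ j) \<le> C * (1 / r) ^ (i + j)" for i j
  proof -
    have "sum g {(i, j)} \<le> infsum g UNIV"
      using s r by (intro finite_sum_le_infsum) (auto simp: g_def)
    then have "norm (F $ i $ j) * r ^ (i + j) \<le> C" by (simp add: g_def C_def)
    then show ?thesis using r by (simp add: field_simps)
  qed
  then show "\<exists>C R. \<forall>i j. norm (F $ i $ j) \<le> C * R ^ (i + j)" by blast
qed (auto intro: convergent2I_bound)

lemma convergent2E_bound:
  assumes "convergent2 F"
  obtains C R where "C \<ge> 0" "R \<ge> 1" "\<And>i j. norm (F $ i $ j) \<le> C * R ^ (i + j)"
proof -
  obtain C R where *: "\<And>i j. norm (F $ i $ j) \<le> C * R ^ (i + j)"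
    using assms convergent2_iff_bound by blast
  have C: "C \<ge> 0" using order_trans[OF norm_ge_zero *[of 0 0]] by simp
  have "norm (F $ i $ j) \<le> C * max \<bar>R\<bar> 1 ^ (i + j)" for i j
  proof -
    have "R ^ (i + j) \<le> \<bar>R\<bar> ^ (i + j)"
      by (metis abs_ge_self power_abs)
    also have "\<dots> \<le> max \<bar>R\<bar> 1 ^ (i + j)"
      by (intro power_mono) auto
    finally show ?thesis
      using *[of i j] C by (meson mult_left_mono order_trans)
  qed
  with C that[of C "max \<bar>R\<bar> 1"] show ?thesis by auto
qed

lemma convergent2_finite_support:
  assumes "finite {(i, j). F $ i $ j \<noteq> 0}"
  shows "convergent2 F"
proof (rule convergent2I_bound)
  fix i j
  show "norm (F $ i $ j) \<le> (\<Sum>(i, j)\<in>{(i, j). F $ i $ j \<noteq> 0}. norm (F $ i $ j)) * 1 ^ (i + j)"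
  proof (cases "F $ i $ j = 0")
    case False
    then show ?thesis
      using member_le_sum[of "(i, j)" "{(i, j). F $ i $ j \<noteq> 0}" "\<lambda>(i, j). norm (F $ i $ j)"] assms
      by (auto split: prod.splits)
  qed (auto intro!: sum_nonneg)
qed

lemma convergent2_add:
  assumes "convergent2 F" "convergent2 G"
  shows "convergent2 (F + G)"
proof -
  obtain C R where F: "C \<ge> 0" "R \<ge> 1" "\<And>i j. norm (F $ i $ j) \<le> C * R ^ (i + j)"
    using assms(1) by (rule convergent2E_bound) blast
  obtain C' R' where G: "C' \<ge> 0" "R' \<ge> 1" "\<And>i j. norm (G $ i $ j) \<le> C' * R' ^ (i + j)"
    using assms(2) by (rule convergent2E_bound) blast
  show ?thesis
  proof (rule convergent2I_bound)
    fix i j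
    have "norm ((F + G) $ i $ j) \<le> C * R ^ (i + j) + C' * R' ^ (i + j)"
      using F(3)[of i j] G(3)[of i j] norm_triangle_ineq[of "F $ i $ j" "G $ i $ j"] by simp
    also have "\<dots> \<le> C * max R R' ^ (i + j) + C' * max R R' ^ (i + j)"
      using F G by (intro add_mono mult_left_mono power_mono) auto
    finally show "norm ((F + G) $ i $ j) \<le> (C + C') * max R R' ^ (i + j)"
      by (simp add: algebra_simps)
  qed
qed

lemma convergent2_uminus:
  assumes "convergent2 F"
  shows "convergent2 (- F)"
  using assms by (simp add: convergent2_def)

lemma formal2_mult_nth:
  fixes F G :: formal2
  shows "(F * G) $ i $ j = (\<Sum>k\<le>i. \<Sum>l\<le>j. F $ k $ l * G $ (i - k) $ (j - l))"
  by (simp add: fps_mult_nth fps_sum_nth atLeast0AtMost)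

lemma convergent2_mult:
  assumes "convergent2 F" "convergent2 G"
  shows "convergent2 (F * G)"
proof -
  obtain C R where F: "C \<ge> 0" "R \<ge> 1" "\<And>i j. norm (F $ i $ j) \<le> C * R ^ (i + j)"
    using assms(1) by (rule convergent2E_bound) blast
  obtain C' R' where G: "C' \<ge> 0" "R' \<ge> 1" "\<And>i j. norm (G $ i $ j) \<le> C' * R' ^ (i + j)"
    using assms(2) by (rule convergent2E_bound) blast
  define S where "S = max R R'"
  have S: "S \<ge> 1" "R \<le> S" "R' \<le> S" using F by (auto simp: S_def)
  have F': "norm (F $ i $ j) \<le> C * S ^ (i + j)" for i j
    using F S order_trans[OF F(3)[of i j] mult_left_mono[OF power_mono[of R S "i + j"]]] by simp
  have G': "norm (G $ i $ j) \<le> C' * S ^ (i + j)" for i j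
    using G S order_trans[OF G(3)[of i j] mult_left_mono[OF power_mono[of R' S "i + j"]]] by simp
  show ?thesis
  proof (rule convergent2I_bound)
    fix i j
    have le: "real (Suc n) \<le> 2 ^ n" for n
      using less_exp[of n] by (metis Suc_leI of_nat_le_iff of_nat_numeral of_nat_power)
    have "norm ((F * G) $ i $ j) \<le> (\<Sum>k\<le>i. \<Sum>l\<le>j. norm (F $ k $ l * G $ (i - k) $ (j - l)))"
      unfolding formal2_mult_nth by (intro sum_norm_le order_refl)
    also have "\<dots> \<le> (\<Sum>k\<le>i. \<Sum>l\<le>j. C * C' * S ^ (i + j))"
    proof (intro sum_mono)
      fix k l assume kl: "k \<in> {..i}" "l \<in> {..j}"
      have "norm (F $ k $ l * G $ (i - k) $ (j - l))
              \<le> (C * S ^ (k + l)) * (C' * S ^ ((i - k) + (j - l)))"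
        unfolding norm_mult using F G S by (intro mult_mono F' G') auto
      also have "\<dots> = C * C' * S ^ ((k + l) + ((i - k) + (j - l)))"
        by (simp add: power_add)
      also have "(k + l) + ((i - k) + (j - l)) = i + j" using kl by simp
      finally show "norm (F $ k $ l * G $ (i - k) $ (j - l)) \<le> C * C' * S ^ (i + j)" .
    qed
    also have "\<dots> = (real (Suc i) * real (Suc j)) * (C * C' * S ^ (i + j))"
      by simp
    also have "\<dots> \<le> (2 ^ i * 2 ^ j) * (C * C' * S ^ (i + j))"
      using F G S by (intro mult_right_mono mult_mono le) auto
    also have "\<dots> = C * C' * (2 * S) ^ (i + j)"
      by (simp add: power_add power_mult_distrib)
    finally show "norm ((F * G) $ i $ j) \<le> C * C' * (2 * S) ^ (i + j)" .
  qed
qed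

typedef conv2 = "{F. convergent2 F}"
  morphisms to_formal Abs_conv2
  by (rule exI[of _ 0]) (simp add: convergent2_finite_support)

setup_lifting type_definition_conv2

instantiation conv2 :: comm_ring_1
begin
lift_definition zero_conv2 :: conv2 is 0
  by (simp add: convergent2_finite_support)
lift_definition one_conv2 :: conv2 is 1
proof -
  have "{(i, j). (1::formal2) $ i $ j \<noteq> 0} \<subseteq> {(0, 0)}" by (auto split: if_splits)
  then show "convergent2 1" by (intro convergent2_finite_support) (rule finite_subset, auto)
qed
lift_definition plus_conv2 :: "conv2 \<Rightarrow> conv2 \<Rightarrow> conv2" is "(+)"
  by (rule convergent2_add)
lift_definition uminus_conv2 :: "conv2 \<Rightarrow> conv2" is uminus
  by (rule convergent2_uminus)
lift_definition minus_conv2 :: "conv2 \<Rightarrow> conv2 \<Rightarrow> conv2" is "(-)"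
  by (metis convergent2_add convergent2_uminus diff_conv_add_uminus)
lift_definition times_conv2 :: "conv2 \<Rightarrow> conv2 \<Rightarrow> conv2" is "(*)"
  by (rule convergent2_mult)
instance
  by standard (transfer; simp add: algebra_simps)+
end

instance conv2 :: idom
  by standard (transfer; simp)

definition coeff2 :: "conv2 \<Rightarrow> nat \<Rightarrow> nat \<Rightarrow> complex" where
  "coeff2 h i j = to_formal h $ i $ j"

lift_definition const2 :: "complex \<Rightarrow> conv2" is "\<lambda>c. fps_const (fps_const c)"
proof -
  fix c :: complex
  have "{(i, j). fps_const (fps_const c) $ i $ j \<noteq> 0} \<subseteq> {(0, 0)}" by (auto split: if_splits)
  then show "convergent2 (fps_const (fps_const c))"
    by (intro convergent2_finite_support) (rule finite_subset, auto)
qed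

lift_definition X2 :: conv2 is fps_X
proof -
  have "{(i, j). (fps_X :: formal2) $ i $ j \<noteq> 0} \<subseteq> {(1, 0)}" by (auto simp: fps_X_def split: if_splits)
  then show "convergent2 fps_X" by (intro convergent2_finite_support) (rule finite_subset, auto)
qed

lift_definition Y2 :: conv2 is "fps_const fps_X"
proof -
  have "{(i, j). (fps_const fps_X :: formal2) $ i $ j \<noteq> 0} \<subseteq> {(0, 1)}" by (auto simp: fps_X_def split: if_splits)
  then show "convergent2 (fps_const fps_X)" by (intro convergent2_finite_support) (rule finite_subset, auto)
qed

definition max_ideal :: "conv2 set" where
  "max_ideal = {h. coeff2 h 0 0 = 0}"


section \<open>Derivations\<close>

definition derivation :: "(conv2 \<Rightarrow> conv2) \<Rightarrow> bool" where
  "derivation \<delta> \<longleftrightarrow>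
     (\<forall>g h. \<delta> (g + h) = \<delta> g + \<delta> h) \<and>
     (\<forall>c h. \<delta> (const2 c * h) = const2 c * \<delta> h) \<and>
     (\<forall>g h. \<delta> (g * h) = \<delta> g * h + g * \<delta> h)"

definition Der :: "conv2 \<Rightarrow> (conv2 \<Rightarrow> conv2) set" where
  "Der f = {\<delta>. derivation \<delta> \<and> f dvd \<delta> f}"

definition scale_map :: "conv2 \<Rightarrow> (conv2 \<Rightarrow> conv2) \<Rightarrow> conv2 \<Rightarrow> conv2" where
  "scale_map a \<delta> = (\<lambda>h. a * \<delta> h)"

lemma module_scale_map: "module scale_map"
  by unfold_locales (simp_all add: scale_map_def fun_eq_iff algebra_simps)

definition is_basis :: "(conv2 \<Rightarrow> conv2) set \<Rightarrow> (conv2 \<Rightarrow> conv2) set \<Rightarrow> bool" where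
  "is_basis B M \<longleftrightarrow> \<not> module.dependent scale_map B \<and> module.span scale_map B = M"

definition singular :: "(conv2 \<Rightarrow> conv2) \<Rightarrow> bool" where
  "singular \<delta> \<longleftrightarrow> \<delta> X2 \<in> max_ideal \<and> \<delta> Y2 \<in> max_ideal"

text \<open>
  A derivation \<open>\<delta>\<close> equals \<open>\<delta>(x) \<partial>\<^sub>x + \<delta>(y) \<partial>\<^sub>y\<close>; the same formula on formal power series is its
  extension to the completion, see \<open>formal_extension_to_formal\<close> below.
\<close>

definition formal_extension :: "(conv2 \<Rightarrow> conv2) \<Rightarrow> formal2 \<Rightarrow> formal2" where
  "formal_extension \<delta> F =
     to_formal (\<delta> X2) * formal_dx F + to_formal (\<delta> Y2) * formal_dy F"

definition topologically_nilpotent :: "(conv2 \<Rightarrow> conv2) \<Rightarrow> bool" where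
  "topologically_nilpotent \<delta> \<longleftrightarrow> singular \<delta> \<and>
     (\<forall>h n. \<forall>\<^sub>F m in sequentially.
        (formal_extension \<delta> ^^ m) h \<in> ideal_power formal_max_ideal n)"

text \<open>Two auxiliary shifts: \<open>h = h(0) + x \<cdot> shift_x h + y \<cdot> shift_y h\<close>.\<close>

lift_definition shift_x :: "conv2 \<Rightarrow> conv2" is "\<lambda>F. Abs_fps (\<lambda>i. F $ Suc i)"
proof -
  fix F :: formal2
  assume "convergent2 F"
  then obtain C R where F: "\<And>i j. norm (F $ i $ j) \<le> C * R ^ (i + j)" "R \<ge> 1"
    by (rule convergent2E_bound) blast
  show "convergent2 (Abs_fps (\<lambda>i. F $ Suc i))"
    by (rule convergent2I_bound[of _ "C * R" R]) (use F(1)[of "Suc _"] in \<open>simp add: mult.assoc\<close>)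
qed

lift_definition shift_y :: "conv2 \<Rightarrow> conv2" is
  "\<lambda>F. fps_const (Abs_fps (\<lambda>j. F $ 0 $ Suc j))"
proof -
  fix F :: formal2
  assume "convergent2 F"
  then obtain C R where F: "\<And>i j. norm (F $ i $ j) \<le> C * R ^ (i + j)" "R \<ge> 1" "C \<ge> 0"
    by (rule convergent2E_bound) blast
  show "convergent2 (fps_const (Abs_fps (\<lambda>j. F $ 0 $ Suc j)))"
  proof (rule convergent2I_bound[of _ "C * R" R])
    fix i j
    show "norm (fps_const (Abs_fps (\<lambda>j. F $ 0 $ Suc j)) $ i $ j) \<le> C * R * R ^ (i + j)"
      using F(1)[of 0 "Suc j"] F(2,3) by (simp add: mult.assoc)
  qed
qed

lemma shift_decomposition:
  "h = const2 (coeff2 h 0 0) + X2 * shift_x h + Y2 * shift_y h"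
  unfolding coeff2_def
proof transfer
  fix F :: formal2
  show "F = fps_const (fps_const (F $ 0 $ 0)) + fps_X * Abs_fps (\<lambda>i. F $ Suc i) +
    fps_const fps_X * fps_const (Abs_fps (\<lambda>j. F $ 0 $ Suc j))"
  proof (intro fps_ext)
    fix i j
    show "F $ i $ j = (fps_const (fps_const (F $ 0 $ 0)) + fps_X * Abs_fps (\<lambda>i. F $ Suc i) +
        fps_const fps_X * fps_const (Abs_fps (\<lambda>j. F $ 0 $ Suc j))) $ i $ j"
      by (cases i; cases j) simp_all
  qed
qed

lemma formal_dx_mult: "formal_dx (F * G) = formal_dx F * G + F * formal_dx G"
  by (simp add: formal_dx_def)

lemma formal_dy_mult: "formal_dy (F * G) = formal_dy F * G + F * formal_dy G"
proof (rule fps_ext)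
  fix i
  show "formal_dy (F * G) $ i = (formal_dy F * G + F * formal_dy G) $ i"
    by (simp add: formal_dy_def fps_mult_nth fps_deriv_sum sum.distrib add.commute)
qed

lemma formal_extension_mult:
  "formal_extension \<delta> (F * G) = formal_extension \<delta> F * G + F * formal_extension \<delta> G"
  by (simp add: formal_extension_def formal_dx_mult formal_dy_mult algebra_simps)

lemma formal_extension_add:
  "formal_extension \<delta> (F + G) = formal_extension \<delta> F + formal_extension \<delta> G"
proof -
  have "formal_dy (F + G) = formal_dy F + formal_dy G"
    by (rule fps_ext) (simp add: formal_dy_def)
  then show ?thesis
    by (simp add: formal_extension_def formal_dx_def algebra_simps)
qed

lemma formal_extension_to_formal:
  assumes "derivation \<delta>"
  shows "formal_extension \<delta> (to_formal h) = to_formal (\<delta> h)"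
proof -
  define D where "D h = to_formal (\<delta> h) - formal_extension \<delta> (to_formal h)" for h
  have add: "D (g + h) = D g + D h" for g h
    using assms by (simp add: D_def derivation_def plus_conv2.rep_eq formal_extension_add)
  have mult: "D (g * h) = D g * to_formal h + to_formal g * D h" for g h
    using assms
    by (simp add: D_def derivation_def plus_conv2.rep_eq times_conv2.rep_eq formal_extension_mult
        algebra_simps)
  have one: "\<delta> 1 = 0"
  proof -
    have "\<delta> (1 * 1) = \<delta> 1 * 1 + 1 * \<delta> 1"
      using assms unfolding derivation_def by blast
    then have "\<delta> 1 + 0 = \<delta> 1 + \<delta> 1" by (simp only: mult_1_left mult_1_right add_0_right)
    then show ?thesis by (simp only: add_left_cancel)
  qed
  have const: "D (const2 c) = 0" for c
  proof -
    have "\<delta> (const2 c * 1) = const2 c * \<delta> 1"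
      using assms unfolding derivation_def by blast
    then have "\<delta> (const2 c) = 0" by (simp add: one)
    moreover have "formal_dy (fps_const (fps_const c)) = 0"
      by (rule fps_ext) (auto simp: formal_dy_def)
    ultimately show ?thesis
      by (simp add: D_def formal_extension_def formal_dx_def const2.rep_eq zero_conv2.rep_eq)
  qed
  have X: "D X2 = 0"
  proof -
    have "formal_dy fps_X = 0"
      by (rule fps_ext) (simp add: formal_dy_def fps_X_def)
    then show ?thesis by (simp add: D_def formal_extension_def formal_dx_def X2.rep_eq)
  qed
  have Y: "D Y2 = 0"
  proof -
    have "formal_dy (fps_const fps_X) = 1"
      by (rule fps_ext) (auto simp: formal_dy_def)
    then show ?thesis by (simp add: D_def formal_extension_def formal_dx_def Y2.rep_eq)
  qed
  have rec: "D h = fps_X * D (shift_x h) + fps_const fps_X * D (shift_y h)" for h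
    by (subst shift_decomposition[of h])
      (simp add: add mult const X Y X2.rep_eq Y2.rep_eq)
  have "D h $ i $ j = 0" for i j
  proof (induction "i + j" arbitrary: h i j rule: less_induct)
    case less
    have "D h $ i $ j = (fps_X * D (shift_x h)) $ i $ j + (fps_const fps_X * D (shift_y h)) $ i $ j"
      by (subst rec) simp
    also have "(fps_X * D (shift_x h)) $ i $ j = 0"
      using less[of "i - 1" j] by (cases i) simp_all
    also have "(fps_const fps_X * D (shift_y h)) $ i $ j = 0"
      using less[of i "j - 1"] by (cases j) simp_all
    finally show ?case by simp
  qed
  then have "D h = 0" by (intro fps_ext) simp
  then show ?thesis by (simp add: D_def)
qed


section \<open>Local coordinates and linear parts\<close>

text \<open>Nonvanishing of the Jacobian determinant at the origin (inverse function theorem).\<close>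

definition local_coordinates :: "conv2 \<Rightarrow> conv2 \<Rightarrow> bool" where
  "local_coordinates x y \<longleftrightarrow> x \<in> max_ideal \<and> y \<in> max_ideal \<and>
     coeff2 x 1 0 * coeff2 y 0 1 - coeff2 x 0 1 * coeff2 y 1 0 \<noteq> 0"

text \<open>
  \<open>expands_as x y h k\<close> says that \<open>k\<close> is the power series of \<open>h\<close> in the coordinates \<open>x, y\<close>, that is
  \<open>h = (\<Sum>i j. k\<^sub>i\<^sub>j x\<^sup>i y\<^sup>j)\<close>. For \<open>x, y\<close> in the maximal ideal, \<open>x\<^sup>i y\<^sup>j\<close> has no terms of degree
  below \<open>i + j\<close>, so that the sums below omit only zero summands.
\<close>

definition expands_as :: "conv2 \<Rightarrow> conv2 \<Rightarrow> conv2 \<Rightarrow> conv2 \<Rightarrow> bool" where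
  "expands_as x y h k \<longleftrightarrow>
     (\<forall>m n. coeff2 h m n = (\<Sum>i\<le>m+n. \<Sum>j\<le>m+n. coeff2 k i j * coeff2 (x ^ i * y ^ j) m n))"

text \<open>
  \<open>has_linear_part x y \<delta> a1 b1\<close>: in the coordinates \<open>x, y\<close>, the linear part of \<open>\<delta>\<close> is
  \<open>a1 \<partial>\<^sub>x + b1 \<partial>\<^sub>y\<close>. The coefficients of \<open>\<delta>\<close> with respect to \<open>\<partial>\<^sub>x, \<partial>\<^sub>y\<close> are \<open>\<delta> x\<close> and \<open>\<delta> y\<close>.
\<close>

definition has_linear_part ::
    "conv2 \<Rightarrow> conv2 \<Rightarrow> (conv2 \<Rightarrow> conv2) \<Rightarrow> conv2 \<Rightarrow> conv2 \<Rightarrow> bool" where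
  "has_linear_part x y \<delta> a1 b1 \<longleftrightarrow>
     (\<exists>a b. expands_as x y (\<delta> x) a \<and> expands_as x y (\<delta> y) b \<and>
        a1 = const2 (coeff2 a 1 0) * x + const2 (coeff2 a 0 1) * y \<and>
        b1 = const2 (coeff2 b 1 0) * x + const2 (coeff2 b 0 1) * y)"

end

(* With x the first coordinate, a submodule of O^2 that is saturated with respect to x and contains
   g O^2 for some g not divisible by x is free: its reduction modulo x is generated by two elements
   over the discrete valuation ring C{y}, and lifts of generators still generate, by a convergent division
   algorithm.  Likewise, saturated ideals containing such a g are principal.  This makes Der_f free and
   replaces unique factorisation: if f is reduced and h f_x, h f_y lie in (f), so does h.  Hence the
   determinant of a basis of Der_f is divisible by f and has order at least 3.  The elements of Der_f are
   singular, because (f, f_x, f_y) is Der_f-stable, proper, and contains powers of x and y.  So the linear parts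
   A, B of a basis satisfy det(A z, B z) = 0 for all z: either some combination of A and B vanishes, or A and B
   have the same one-dimensional image, which a linear change of coordinates turns into the x-axis. *)

theory Submission
  imports Defs
begin

section \<open>Coefficients of convergent power series\<close>

text \<open>The coordinate \<open>X2\<close> is fixed rather than chosen generic for the curve, so
  it may divide \<open>f\<close>. Then \<open>Der f\<close> is not saturated with respect to
  \<open>X2\<close>: for \<open>f = X2\<close> it contains X2 d/dx but not d/dx. Squarefreeness
  gives f = X2 * g with \<open>g\<close> not divisible by \<open>X2\<close>, and everything is
  rewritten as a congruence modulo \<open>g\<close>. Passing from \<open>f\<close> to
  \<open>g\<close> costs one order of vanishing, which order 3 affords: \<open>g\<close> and its
  partial derivatives still vanish at the origin. Generators of principal ideal quotients stand in
  for greatest common divisors. The determinant serves twice: it is nonzero, so the two generators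
  are independent, and it has order 3, so its degree 2 part, which only depends on the linear parts,
  is zero. In the second alternative the parameter a is always made 0, by subtracting a multiple of
  the first generator from the second.\<close>

lemma conv2_eqI:
  assumes "\<And>i j. coeff2 g i j = coeff2 h i j"
  shows "g = h"
proof -
  have "to_formal g = to_formal h"
    by (intro fps_ext) (use assms in \<open>simp add: coeff2_def\<close>)
  then show ?thesis by (simp add: to_formal_inject)
qed

lemma conv2_of_coeffs:
  assumes "\<And>i j. norm (c i j) \<le> C * R ^ (i + j)"
  shows "\<exists>h. \<forall>i j. coeff2 h i j = c i j"
proof -
  have "convergent2 (Abs_fps (\<lambda>i. Abs_fps (c i)))"
    by (rule convergent2I_bound[of _ C R]) (simp add: assms)
  then have "coeff2 (Abs_conv2 (Abs_fps (\<lambda>i. Abs_fps (c i)))) i j = c i j" for i j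
    by (simp add: coeff2_def Abs_conv2_inverse)
  then show ?thesis by blast
qed

lemma coeff2_bound:
  obtains C R where "C \<ge> 0" "R \<ge> 1" "\<And>i j. norm (coeff2 h i j) \<le> C * R ^ (i + j)"
  using convergent2E_bound[of "to_formal h"] to_formal[of h] unfolding coeff2_def by auto

lemma coeff2_zero [simp]: "coeff2 0 i j = 0"
  and coeff2_one: "coeff2 1 i j = (if i = 0 \<and> j = 0 then 1 else 0)"
  and coeff2_add [simp]: "coeff2 (g + h) i j = coeff2 g i j + coeff2 h i j"
  and coeff2_diff [simp]: "coeff2 (g - h) i j = coeff2 g i j - coeff2 h i j"
  and coeff2_uminus [simp]: "coeff2 (- g) i j = - coeff2 g i j"
  by (auto simp: coeff2_def zero_conv2.rep_eq one_conv2.rep_eq plus_conv2.rep_eq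
      minus_conv2.rep_eq uminus_conv2.rep_eq)

lemma coeff2_sum: "coeff2 (sum F A) i j = (\<Sum>a\<in>A. coeff2 (F a) i j)"
  by (induction A rule: infinite_finite_induct) auto

lemma coeff2_mult:
  "coeff2 (g * h) i j = (\<Sum>k\<le>i. \<Sum>l\<le>j. coeff2 g k l * coeff2 h (i - k) (j - l))"
  by (simp add: coeff2_def times_conv2.rep_eq formal2_mult_nth)

lemma coeff2_const: "coeff2 (const2 c) i j = (if i = 0 \<and> j = 0 then c else 0)"
  by (auto simp: coeff2_def const2.rep_eq)

lemma coeff2_X: "coeff2 X2 i j = (if i = 1 \<and> j = 0 then 1 else 0)"
  by (auto simp: coeff2_def X2.rep_eq fps_X_def)

lemma coeff2_Y: "coeff2 Y2 i j = (if i = 0 \<and> j = 1 then 1 else 0)"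
  by (auto simp: coeff2_def Y2.rep_eq fps_X_def)

lemma coeff2_const_mult [simp]: "coeff2 (const2 c * h) i j = c * coeff2 h i j"
  by (simp add: coeff2_def const2.rep_eq times_conv2.rep_eq)

lemma coeff2_X_mult: "coeff2 (X2 * h) i j = (case i of 0 \<Rightarrow> 0 | Suc k \<Rightarrow> coeff2 h k j)"
  by (cases i) (simp_all add: coeff2_def X2.rep_eq times_conv2.rep_eq)

lemma coeff2_Y_mult: "coeff2 (Y2 * h) i j = (case j of 0 \<Rightarrow> 0 | Suc k \<Rightarrow> coeff2 h i k)"
  by (cases j) (simp_all add: coeff2_def Y2.rep_eq times_conv2.rep_eq)

lemma coeff2_shift_x: "coeff2 (shift_x h) i j = coeff2 h (Suc i) j"
  by (simp add: coeff2_def shift_x.rep_eq)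

lemma coeff2_mult_row0: "coeff2 (g * h) 0 j = (\<Sum>l\<le>j. coeff2 g 0 l * coeff2 h 0 (j - l))"
  by (simp add: coeff2_mult)

lemma coeff2_mult_00 [simp]: "coeff2 (g * h) 0 0 = coeff2 g 0 0 * coeff2 h 0 0"
  by (simp add: coeff2_mult)

lemma X2_nonzero [simp]: "X2 \<noteq> 0"
proof
  assume "X2 = 0"
  then have "coeff2 X2 1 0 = 0" by (simp only: coeff2_zero)
  then show False by (simp add: coeff2_X)
qed

lemma X2_mult_shift_x:
  assumes "\<And>j. coeff2 h 0 j = 0"
  shows "X2 * shift_x h = h"
  by (rule conv2_eqI) (auto simp: coeff2_X_mult coeff2_shift_x assms split: nat.splits)

lemma X2_dvd_iff: "X2 dvd h \<longleftrightarrow> (\<forall>j. coeff2 h 0 j = 0)"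
proof
  assume "X2 dvd h"
  then show "\<forall>j. coeff2 h 0 j = 0" by (auto simp: coeff2_X_mult elim!: dvdE)
next
  assume "\<forall>j. coeff2 h 0 j = 0"
  then show "X2 dvd h" by (metis X2_mult_shift_x dvd_triv_left)
qed

text \<open>\<open>X2\<close> is prime: reduction modulo it is the passage to row 0, with values in
  the domain of power series in y.\<close>

lemma X2_dvd_mult_iff: "X2 dvd g * h \<longleftrightarrow> X2 dvd g \<or> X2 dvd h"
proof -
  have "X2 dvd k \<longleftrightarrow> to_formal k $ 0 = 0" for k
    by (simp add: X2_dvd_iff coeff2_def fps_eq_iff)
  then show ?thesis by (simp add: times_conv2.rep_eq)
qed

text \<open>The source of all saturation statements below.\<close>

lemma dvd_X2_mult_cancel:
  assumes "\<not> X2 dvd g" and "g dvd X2 * h"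
  shows "g dvd h"
proof -
  obtain k where k: "X2 * h = g * k" using assms(2) by blast
  have "X2 dvd k" using assms(1) k X2_dvd_mult_iff dvd_triv_left by metis
  then obtain l where "k = X2 * l" by blast
  with k have "X2 * h = X2 * (g * l)" by (simp add: algebra_simps)
  then show ?thesis by simp
qed


section \<open>Division\<close>

text \<open>The quotient of row 0 by y^p. It contains no positive power of \<open>X2\<close>, so
  each division step fills exactly one row of the final quotient.\<close>

lift_definition row_shift :: "nat \<Rightarrow> conv2 \<Rightarrow> conv2" is
  "\<lambda>p F. fps_const (Abs_fps (\<lambda>j. F $ 0 $ (j + p)))"
proof -
  fix p and F :: formal2
  assume "convergent2 F"
  then obtain C R where F: "\<And>i j. norm (F $ i $ j) \<le> C * R ^ (i + j)" "R \<ge> 1" "C \<ge> 0"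
    by (rule convergent2E_bound) blast
  show "convergent2 (fps_const (Abs_fps (\<lambda>j. F $ 0 $ (j + p))))"
  proof (rule convergent2I_bound[of _ "C * R ^ p" R])
    fix i j
    show "norm (fps_const (Abs_fps (\<lambda>j. F $ 0 $ (j + p))) $ i $ j) \<le> C * R ^ p * R ^ (i + j)"
      using F(1)[of 0 "j + p"] F(2,3) by (simp add: power_add mult_ac)
  qed
qed

lemma coeff2_row_shift:
  "coeff2 (row_shift p h) i j = (if i = 0 then coeff2 h 0 (j + p) else 0)"
  by (simp add: coeff2_def row_shift.rep_eq)

text \<open>Two radii: the division enlarges the radius in y once and for all, to leave room for
  convolutions in y, while x is handled row by row.\<close>

definition majorized :: "real \<Rightarrow> real \<Rightarrow> real \<Rightarrow> conv2 \<Rightarrow> bool" where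
  "majorized E R S h \<longleftrightarrow> (\<forall>i j. norm (coeff2 h i j) \<le> E * R ^ i * S ^ j)"

lemma majorized_diff:
  assumes "majorized E R S g" "majorized E' R S h"
  shows "majorized (E + E') R S (g - h)"
  unfolding majorized_def
proof (intro allI)
  fix i j
  show "norm (coeff2 (g - h) i j) \<le> (E + E') * R ^ i * S ^ j"
    using assms[unfolded majorized_def, rule_format, of i j]
      norm_triangle_ineq4[of "coeff2 g i j" "coeff2 h i j"]
    by (simp add: algebra_simps)
qed

lemma majorized_shift_x:
  assumes "majorized E R S h"
  shows "majorized (E * R) R S (shift_x h)"
  using assms unfolding majorized_def coeff2_shift_x by (metis mult.assoc power_Suc)

lemma majorized_row_shift:
  assumes "majorized E R S h" "E \<ge> 0" "R \<ge> 0" "S \<ge> 0"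
  shows "majorized (E * S ^ p) R S (row_shift p h)"
  unfolding majorized_def
proof (intro allI)
  fix i j
  show "norm (coeff2 (row_shift p h) i j) \<le> E * S ^ p * R ^ i * S ^ j"
    using assms(1)[unfolded majorized_def, rule_format, of 0 "j + p"] assms(2-)
    by (simp add: coeff2_row_shift power_add mult_ac)
qed

lemma sum_half_powers_le: "(\<Sum>l\<le>j. (1 / 2 :: real) ^ l) \<le> 2"
  by (simp add: sum_gp0)

text \<open>A factor living in row 0 causes no convolution in x. In y the radii \<open>2 * R\<close>
  and \<open>R\<close> turn the convolution into a geometric series of sum at most 2.\<close>

lemma majorized_row_mult:
  assumes "majorized E R (2 * R) (row_shift p h)" "majorized B R R g" "E \<ge> 0" "B \<ge> 0" "R \<ge> 1"
  shows "majorized (2 * B * E) R (2 * R) (row_shift p h * g)"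
  unfolding majorized_def
proof (intro allI)
  fix i j
  let ?c = "row_shift p h"
  have "coeff2 (?c * g) i j = (\<Sum>k\<le>i. if k = 0 then \<Sum>l\<le>j. coeff2 ?c 0 l * coeff2 g i (j - l) else 0)"
    unfolding coeff2_mult by (intro sum.cong) (auto simp: coeff2_row_shift)
  also have "\<dots> = (\<Sum>l\<le>j. coeff2 ?c 0 l * coeff2 g i (j - l))"
    by simp
  also have "norm \<dots> \<le> (\<Sum>l\<le>j. (E * R ^ 0 * (2 * R) ^ l) * (B * R ^ i * R ^ (j - l)))"
    unfolding norm_mult[symmetric]
    by (intro sum_norm_le) (use assms in \<open>auto simp: majorized_def norm_mult simp del: power_0 intro!: mult_mono\<close>)
  also have "\<dots> = (\<Sum>l\<le>j. E * B * R ^ i * (2 * R) ^ j * (1 / 2) ^ (j - l))"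
  proof (intro sum.cong refl)
    fix l assume "l \<in> {..j}"
    then obtain m where m: "j = l + m" using le_Suc_ex by auto
    show "(E * R ^ 0 * (2 * R) ^ l) * (B * R ^ i * R ^ (j - l)) =
        E * B * R ^ i * (2 * R) ^ j * (1 / 2) ^ (j - l)"
      by (simp add: m power_add power_mult_distrib power_divide)
  qed
  also have "\<dots> = E * B * R ^ i * (2 * R) ^ j * (\<Sum>l\<le>j. (1 / 2) ^ (j - l))"
    by (simp add: sum_distrib_left)
  also have "(\<Sum>l\<le>j. (1 / 2 :: real) ^ (j - l)) = (\<Sum>l\<le>j. (1 / 2) ^ l)"
    by (rule sum.reindex_bij_witness[of _ "\<lambda>l. j - l" "\<lambda>l. j - l"]) auto
  also have "E * B * R ^ i * (2 * R) ^ j * (\<Sum>l\<le>j. (1 / 2) ^ l) \<le> E * B * R ^ i * (2 * R) ^ j * 2"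
    using assms by (intro mult_left_mono sum_half_powers_le) auto
  finally show "norm (coeff2 (?c * g) i j) \<le> 2 * B * E * R ^ i * (2 * R) ^ j"
    by (simp add: mult_ac)
qed

lemma majorized_mono:
  assumes "majorized E R S h" "E \<le> E'" "R \<le> R'" "S \<le> S'" "E \<ge> 0" "R \<ge> 0" "S \<ge> 0"
  shows "majorized E' R' S' h"
  unfolding majorized_def
proof (intro allI)
  fix i j
  have "norm (coeff2 h i j) \<le> E * R ^ i * S ^ j" using assms(1) by (simp add: majorized_def)
  also have "\<dots> \<le> E' * R' ^ i * S' ^ j"
    using assms(2-) by (intro mult_mono power_mono) auto
  finally show "norm (coeff2 h i j) \<le> E' * R' ^ i * S' ^ j" .
qed

lemma majorized_exists:
  obtains E R where "E \<ge> 0" "R \<ge> 1" "majorized E R R h"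
proof -
  obtain C R where "C \<ge> 0" "R \<ge> 1" "\<And>i j. norm (coeff2 h i j) \<le> C * R ^ (i + j)"
    using coeff2_bound[of h] by blast
  then show ?thesis by (intro that[of C R]) (auto simp: majorized_def power_add mult_ac)
qed

lemma majorized_finite:
  assumes "finite A"
  obtains E R where "E \<ge> 0" "R \<ge> 1" "\<And>h. h \<in> A \<Longrightarrow> majorized E R R h"
proof -
  have "\<exists>E R. E \<ge> 0 \<and> R \<ge> 1 \<and> (\<forall>h\<in>A. majorized E R R h)"
    using assms
  proof induction
    case (insert h A)
    then obtain E R where ER: "E \<ge> 0" "R \<ge> 1" "\<And>h. h \<in> A \<Longrightarrow> majorized E R R h" by auto
    obtain E' R' where ER': "E' \<ge> 0" "R' \<ge> 1" "majorized E' R' R' h"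
      using majorized_exists by blast
    show ?case
      by (rule exI[of _ "max E E'"], rule exI[of _ "max R R'"])
        (use ER ER' in \<open>auto intro: majorized_mono[of E R R] majorized_mono[of E' R' R']\<close>)
  qed (use zero_le_one in blast)
  then show ?thesis using that by blast
qed

text \<open>Modulo \<open>X2\<close> the divisor is y^p and \<open>a\<close> is a multiple of y^p,
  so \<open>row_shift\<close> is the exact quotient.\<close>

lemma row_quotient_row0:
  assumes a1: "\<And>j. coeff2 a1 0 j = (if j = p then 1 else 0)"
    and a: "\<And>j. j < p \<Longrightarrow> coeff2 a 0 j = 0"
  shows "coeff2 (a - row_shift p a * a1) 0 j = 0"
proof -
  have "coeff2 (row_shift p a * a1) 0 j = (\<Sum>l\<le>j. if j - l = p then coeff2 a 0 (l + p) else 0)"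
    by (auto simp: coeff2_mult_row0 coeff2_row_shift a1 intro!: sum.cong)
  also have "\<dots> = (\<Sum>l\<le>j. if p \<le> j \<and> l = j - p then coeff2 a 0 j else 0)"
    using a[of j] by (intro sum.cong) auto
  also have "\<dots> = coeff2 a 0 j"
    using a[of j] by (cases "p \<le> j") auto
  finally show ?thesis by simp
qed

text \<open>
  Modulo \<open>X2\<close> the two generators are \<open>(y\<^sup>p, \<dots>)\<close> and \<open>(0, y\<^sup>q)\<close>. Dividing by them modulo \<open>X2\<close>, cancelling
  \<open>X2\<close> in the remainder and repeating produces the quotients row by row; each step multiplies the majorant by a
  constant only, so the quotients converge.
\<close>

lemma division_lemma:
  fixes M :: "conv2 \<Rightarrow> conv2 \<Rightarrow> bool"
  assumes a1: "\<And>j. coeff2 a1 0 j = (if j = p then 1 else 0)"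
    and a2: "\<And>j. coeff2 a2 0 j = 0"
    and b2: "\<And>j. coeff2 b2 0 j = (if j = q then 1 else 0)"
    and p: "\<And>a b j. M a b \<Longrightarrow> j < p \<Longrightarrow> coeff2 a 0 j = 0"
    and q: "\<And>a b j. M a b \<Longrightarrow> j < q \<Longrightarrow> coeff2 (b - row_shift p a * b1) 0 j = 0"
    and closed: "\<And>a b c d a' b'. M a b \<Longrightarrow> a - c * a1 - d * a2 = X2 * a' \<Longrightarrow>
      b - c * b1 - d * b2 = X2 * b' \<Longrightarrow> M a' b'"
    and M: "M a b"
  shows "\<exists>c d. a = c * a1 + d * a2 \<and> b = c * b1 + d * b2"
proof -
  define qc where "qc a = row_shift p a" for a
  define qd where "qd a b = row_shift q (b - qc a * b1)" for a b
  define ra where "ra a b = a - qc a * a1 - qd a b * a2" for a b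
  define rb where "rb a b = b - qc a * b1 - qd a b * b2" for a b
  \<comment> \<open>The pair of remainders after k steps, with one factor \<open>X2\<close> removed
    at each step.\<close>
  define s where "s k = ((\<lambda>(a, b). (shift_x (ra a b), shift_x (rb a b))) ^^ k) (a, b)" for k
  define A where "A k = fst (s k)" for k
  define B where "B k = snd (s k)" for k
  have A0: "A 0 = a" "B 0 = b" by (simp_all add: A_def B_def s_def)
  have AS: "A (Suc k) = shift_x (ra (A k) (B k))" "B (Suc k) = shift_x (rb (A k) (B k))" for k
    by (simp_all add: A_def B_def s_def case_prod_unfold)
  have row: "X2 * shift_x (ra a b) = ra a b" "X2 * shift_x (rb a b) = rb a b" if "M a b" for a b
  proof -
    have "coeff2 (ra a b) 0 j = 0" for j
      using row_quotient_row0[OF a1 p[OF that], of j]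
      by (simp add: ra_def qc_def coeff2_mult_row0[of _ a2] a2)
    then show "X2 * shift_x (ra a b) = ra a b" by (rule X2_mult_shift_x)
    have "coeff2 (rb a b) 0 j = 0" for j
      using row_quotient_row0[OF b2 q[OF that], of j] by (simp only: rb_def qd_def qc_def)
    then show "X2 * shift_x (rb a b) = rb a b" by (rule X2_mult_shift_x)
  qed
  have MA: "M (A k) (B k)" for k
  proof (induction k)
    case (Suc k)
    show ?case unfolding AS
      by (rule closed[OF Suc, of "qc (A k)" "qd (A k) (B k)"])
        (use row[OF Suc] in \<open>simp_all add: ra_def rb_def\<close>)
  qed (simp add: A0 M)
  obtain E R where ER: "E \<ge> 0" "R \<ge> 1"
    "\<And>h. h \<in> {a, b, a1, b1, a2, b2} \<Longrightarrow> majorized E R R h"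
    by (rule majorized_finite[of "{a, b, a1, b1, a2, b2}"]) auto
  \<comment> \<open>\<open>S\<close> provides the slack of \<open>majorized_row_mult\<close>.
    \<open>K\<close> is the growth from subtracting a multiple of the first generator,
    \<open>L\<close> that of a full step; its factor \<open>R\<close> comes from removing
    \<open>X2\<close>.\<close>
  define S where "S = 2 * R"
  define K where "K = 1 + 2 * E * S ^ p"
  define L where "L = (K + 2 * E * (K * S ^ q)) * R"
  have S: "S \<ge> 1" using ER by (simp add: S_def)
  have K: "K \<ge> 0" unfolding K_def using ER S by (intro add_nonneg_nonneg mult_nonneg_nonneg) auto
  have L: "L \<ge> 0" unfolding L_def using ER S K by (intro mult_nonneg_nonneg add_nonneg_nonneg) auto
  have qmaj: "majorized (F * S ^ p) R S (qc a)" "majorized (F * K * S ^ q) R S (qd a b)"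
    "majorized (F * L) R S (shift_x (ra a b))" "majorized (F * L) R S (shift_x (rb a b))"
    if F: "F \<ge> 0" and ab: "majorized F R S a" "majorized F R S b" for F a b
  proof -
    show c: "majorized (F * S ^ p) R S (qc a)"
      unfolding qc_def using F ab S ER by (intro majorized_row_shift) auto
    have cm: "majorized (2 * E * (F * S ^ p)) R S (qc a * h)" if "majorized E R R h" for h
      unfolding qc_def S_def
      by (rule majorized_row_mult) (use c that F ER S in \<open>auto simp: qc_def S_def\<close>)
    have sub: "majorized (F * K) R S (h - qc a * h')"
      if "majorized F R S h" "majorized E R R h'" for h h'
      using majorized_diff[OF that(1) cm[OF that(2)]] by (simp add: K_def algebra_simps)
    have "majorized (F * K) R S (b - qc a * b1)"
      by (rule sub) (use ab ER in auto)
    then show d: "majorized (F * K * S ^ q) R S (qd a b)"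
      unfolding qd_def using F K S ER by (intro majorized_row_shift) auto
    have dm: "majorized (2 * E * (F * K * S ^ q)) R S (qd a b * h)" if "majorized E R R h" for h
      unfolding qd_def S_def
      by (rule majorized_row_mult) (use d that F K ER S in \<open>auto simp: qd_def S_def\<close>)
    have fin: "majorized (F * L) R S (shift_x (h - qc a * h' - qd a b * h''))"
      if "majorized F R S h" "majorized E R R h'" "majorized E R R h''" for h h' h''
      using majorized_shift_x[OF majorized_diff[OF sub[OF that(1,2)] dm[OF that(3)]]]
      by (simp add: L_def algebra_simps)
    show "majorized (F * L) R S (shift_x (ra a b))" "majorized (F * L) R S (shift_x (rb a b))"
      unfolding ra_def rb_def by (intro fin; use ab ER in simp)+
  qed
  have maj: "majorized (E * L ^ k) R S (A k) \<and> majorized (E * L ^ k) R S (B k)" for k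
  proof (induction k)
    case 0
    have "majorized E R S h" if "h \<in> {a, b}" for h
      by (rule majorized_mono[of E R R]) (use ER that in \<open>auto simp: S_def\<close>)
    then show ?case by (simp add: A0)
  next
    case (Suc k)
    show ?case unfolding AS
      using qmaj(3,4)[of "E * L ^ k" "A k" "B k"] Suc ER L by (simp add: mult_ac)
  qed
  \<comment> \<open>Row k of a quotient is taken from step k. The growth \<open>L ^ k\<close> only
    shrinks the radius of convergence in x.\<close>
  have quot: "\<exists>C. \<forall>k j. coeff2 C k j = coeff2 (c k) 0 j"
    if "\<And>k. majorized (E * L ^ k * G) R S (c k)" "G \<ge> 0" for c G
  proof -
    have "norm (coeff2 (c k) 0 j) \<le> E * G * max L S ^ (k + j)" for k j
    proof -
      have "norm (coeff2 (c k) 0 j) \<le> E * L ^ k * G * R ^ 0 * S ^ j"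
        using that(1)[of k] unfolding majorized_def by blast
      also have "\<dots> = E * G * (L ^ k * S ^ j)" by simp
      also have "\<dots> \<le> E * G * (max L S ^ k * max L S ^ j)"
        using ER that(2) L S by (intro mult_left_mono mult_mono power_mono) auto
      finally show ?thesis by (simp add: power_add)
    qed
    then show ?thesis by (rule conv2_of_coeffs)
  qed
  have "majorized (E * L ^ k * S ^ p) R S (qc (A k))" for k
    using qmaj(1)[of "E * L ^ k" "A k" "B k"] maj[of k] ER L by simp
  then obtain C where C: "\<And>k j. coeff2 C k j = coeff2 (qc (A k)) 0 j"
    using quot[of "S ^ p" "\<lambda>k. qc (A k)"] S by auto
  have "majorized (E * L ^ k * (K * S ^ q)) R S (qd (A k) (B k))" for k
    using qmaj(2)[of "E * L ^ k" "A k" "B k"] maj[of k] ER L by (simp add: mult_ac)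
  then obtain D where D: "\<And>k j. coeff2 D k j = coeff2 (qd (A k) (B k)) 0 j"
    using quot[of "K * S ^ q" "\<lambda>k. qd (A k) (B k)"] S K by auto
  \<comment> \<open>Tails of the quotients from row k on, intended as quotients for the remainders
    \<open>A k\<close> and \<open>B k\<close>.\<close>
  define Ck where "Ck k = (shift_x ^^ k) C" for k
  define Dk where "Dk k = (shift_x ^^ k) D" for k
  have it: "coeff2 ((shift_x ^^ k) h) i j = coeff2 h (k + i) j" for k h i j
    by (induction k arbitrary: i) (simp_all add: coeff2_shift_x)
  have CS: "Ck k = qc (A k) + X2 * Ck (Suc k)" for k
    by (rule conv2_eqI)
      (auto simp: Ck_def it C coeff2_X_mult qc_def coeff2_row_shift simp del: funpow.simps split: nat.splits)
  have DS: "Dk k = qd (A k) (B k) + X2 * Dk (Suc k)" for k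
    by (rule conv2_eqI)
      (auto simp: Dk_def it D coeff2_X_mult qd_def coeff2_row_shift simp del: funpow.simps split: nat.splits)
  \<comment> \<open>If each error is \<open>X2\<close> times the next one, the first is divisible by
    all powers of \<open>X2\<close>, hence zero.\<close>
  have van: "e 0 = 0" if e: "\<And>k. e k = X2 * e (Suc k)" for e :: "nat \<Rightarrow> conv2"
  proof (rule conv2_eqI)
    fix i j
    have "coeff2 (e k) i j = 0" for k
    proof (induction i arbitrary: k)
      case 0
      show ?case by (subst e) (simp add: coeff2_X_mult)
    next
      case (Suc i)
      show ?case by (subst e) (simp add: coeff2_X_mult Suc)
    qed
    then show "coeff2 (e 0) i j = coeff2 0 i j" by simp
  qed
  have "(\<lambda>k. A k - Ck k * a1 - Dk k * a2) 0 = 0"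
  proof (rule van)
    fix k
    have "A k = qc (A k) * a1 + qd (A k) (B k) * a2 + X2 * A (Suc k)"
      using row(1)[OF MA[of k]] unfolding AS by (simp add: ra_def)
    then show "A k - Ck k * a1 - Dk k * a2 = X2 * (A (Suc k) - Ck (Suc k) * a1 - Dk (Suc k) * a2)"
      by (subst CS, subst DS) (simp add: algebra_simps)
  qed
  moreover have "(\<lambda>k. B k - Ck k * b1 - Dk k * b2) 0 = 0"
  proof (rule van)
    fix k
    have "B k = qc (A k) * b1 + qd (A k) (B k) * b2 + X2 * B (Suc k)"
      using row(2)[OF MA[of k]] unfolding AS by (simp add: rb_def)
    then show "B k - Ck k * b1 - Dk k * b2 = X2 * (B (Suc k) - Ck (Suc k) * b1 - Dk (Suc k) * b2)"
      by (subst CS, subst DS) (simp add: algebra_simps)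
  qed
  ultimately have "a = C * a1 + D * a2 \<and> b = C * b1 + D * b2"
    by (simp add: A0 Ck_def Dk_def algebra_simps)
  then show ?thesis by blast
qed

section \<open>Units, and orders in y of row 0\<close>

lemma row_inverse_exists:
  assumes "coeff2 h 0 0 \<noteq> 0"
  shows "\<exists>w. \<forall>j. coeff2 (w * h) 0 j = (if j = 0 then 1 else 0)"
proof -
  define g where "g = const2 (inverse (coeff2 h 0 0)) * h"
  have g0: "coeff2 g 0 0 = 1" using assms by (simp add: g_def coeff2_const)
  define v where "v = inverse (to_formal g $ 0)"
  have vg: "v * (to_formal g $ 0) = 1"
    unfolding v_def using g0 by (intro inverse_mult_eq_1) (simp add: coeff2_def)
  obtain C R where CR: "C \<ge> 0" "R \<ge> 1" "\<And>i j. norm (coeff2 g i j) \<le> C * R ^ (i + j)"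
    using coeff2_bound[of g] by blast
  \<comment> \<open>The base \<open>1 + C\<close> closes the recursion: \<open>C\<close> times the
    sum of (1 + C)^l over l < n is (1 + C)^n - 1.\<close>
  have bound: "norm (v $ n) \<le> (R * (1 + C)) ^ n" for n
  proof (induction n rule: less_induct)
    case (less n)
    show ?case
    proof (cases n)
      case 0
      have "v $ 0 = 1" using g0 by (simp add: v_def coeff2_def)
      then show ?thesis using 0 by simp
    next
      case (Suc m)
      have "0 = (v * (to_formal g $ 0)) $ n" using Suc by (simp add: vg)
      also have "\<dots> = (\<Sum>l\<le>m. v $ l * coeff2 g 0 (n - l)) + v $ n"
        using g0 by (simp add: fps_mult_nth coeff2_def atLeast0AtMost Suc)
      finally have "v $ n = - (\<Sum>l\<le>m. v $ l * coeff2 g 0 (n - l))"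
        by (simp add: eq_neg_iff_add_eq_0 add.commute)
      then have "norm (v $ n) = norm (\<Sum>l\<le>m. v $ l * coeff2 g 0 (n - l))" by simp
      also have "\<dots> \<le> (\<Sum>l\<le>m. (R * (1 + C)) ^ l * (C * R ^ (n - l)))"
      proof (intro sum_norm_le)
        fix l assume "l \<in> {..m}"
        then have "norm (v $ l) \<le> (R * (1 + C)) ^ l" using less Suc by simp
        moreover have "norm (coeff2 g 0 (n - l)) \<le> C * R ^ (n - l)" using CR(3)[of 0 "n - l"] by simp
        ultimately show "norm (v $ l * coeff2 g 0 (n - l)) \<le> (R * (1 + C)) ^ l * (C * R ^ (n - l))"
          unfolding norm_mult using CR by (intro mult_mono) auto
      qed
      also have "\<dots> = (\<Sum>l\<le>m. R ^ n * (C * (1 + C) ^ l))"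
      proof (intro sum.cong refl)
        fix l assume "l \<in> {..m}"
        then obtain k where "n = l + k" using Suc le_Suc_ex[of l n] by auto
        then show "(R * (1 + C)) ^ l * (C * R ^ (n - l)) = R ^ n * (C * (1 + C) ^ l)"
          by (simp add: power_add power_mult_distrib)
      qed
      also have "\<dots> = R ^ n * (C * (\<Sum>l\<le>m. (1 + C) ^ l))"
        by (simp add: sum_distrib_left)
      also have "C * (\<Sum>l\<le>m. (1 + C) ^ l) = (1 + C) ^ n - 1"
        using power_diff_1_eq[of "1 + C" n] by (simp add: Suc lessThan_Suc_atMost)
      also have "R ^ n * ((1 + C) ^ n - 1) \<le> (R * (1 + C)) ^ n"
        using CR by (simp add: power_mult_distrib right_diff_distrib)
      finally show ?thesis .
    qed
  qed
  have "norm (if i = 0 then v $ j else 0) \<le> 1 * (R * (1 + C)) ^ (i + j)" for i j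
    using bound[of j] CR by auto
  from conv2_of_coeffs[OF this]
  obtain w where w: "\<And>i j. coeff2 w i j = (if i = 0 then v $ j else 0)" by blast
  have "coeff2 (w * g) 0 j = (v * (to_formal g $ 0)) $ j" for j
    unfolding coeff2_mult_row0 w fps_mult_nth atLeast0AtMost by (simp add: coeff2_def)
  then have "coeff2 (w * g) 0 j = (if j = 0 then 1 else 0)" for j by (simp add: vg)
  then have "\<forall>j. coeff2 ((const2 (inverse (coeff2 h 0 0)) * w) * h) 0 j = (if j = 0 then 1 else 0)"
    by (simp add: g_def mult_ac)
  then show ?thesis by blast
qed

text \<open>Row 0 is a nonzero element of the discrete valuation ring C{y}, that is, y^p times a
  unit; \<open>w\<close> inverts the unit.\<close>

lemma row_normalize:
  assumes "\<And>j. j < p \<Longrightarrow> coeff2 h 0 j = 0" and "coeff2 h 0 p \<noteq> 0"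
  obtains w where "\<And>j. coeff2 (w * h) 0 j = (if j = p then 1 else 0)"
proof -
  have "coeff2 (row_shift p h) 0 0 \<noteq> 0" using assms(2) by (simp add: coeff2_row_shift)
  then obtain w where w: "\<And>j. coeff2 (w * row_shift p h) 0 j = (if j = 0 then 1 else 0)"
    using row_inverse_exists by blast
  have "coeff2 (w * h) 0 j = (if j = p then 1 else 0)" for j
  proof (cases "j < p")
    case True
    then show ?thesis by (simp add: coeff2_mult_row0 assms(1))
  next
    case False
    then obtain k where k: "j = k + p" by (metis add.commute le_Suc_ex not_less)
    have "coeff2 (w * h) 0 j = (\<Sum>l\<le>k + p. coeff2 w 0 l * coeff2 h 0 (k + p - l))"
      by (simp add: coeff2_mult_row0 k)
    also have "\<dots> = (\<Sum>l\<le>k. coeff2 w 0 l * coeff2 h 0 (k + p - l))"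
      by (rule sum.mono_neutral_right) (auto simp: assms(1))
    also have "\<dots> = coeff2 (w * row_shift p h) 0 k"
      by (auto simp: coeff2_mult_row0 coeff2_row_shift intro!: sum.cong)
    finally show ?thesis using w[of k] k by simp
  qed
  then show ?thesis by (rule that)
qed

text \<open>For the converse, some multiple of \<open>h\<close> is 1 modulo \<open>X2\<close>; the
  division lemma with \<open>p = q = 0\<close> and no constraint on the pairs divides 1 by it,
  lifting the inverse from C{y} to two variables.\<close>

lemma conv2_unit_iff: "h dvd 1 \<longleftrightarrow> coeff2 h 0 0 \<noteq> 0"
proof
  assume "h dvd 1"
  then obtain k where "1 = h * k" by blast
  then have "coeff2 1 0 0 = coeff2 h 0 0 * coeff2 k 0 0" by (metis coeff2_mult_00)
  then show "coeff2 h 0 0 \<noteq> 0" by (auto simp: coeff2_one)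
next
  assume "coeff2 h 0 0 \<noteq> 0"
  then obtain w where "\<And>j. coeff2 (w * h) 0 j = (if j = 0 then 1 else 0)"
    using row_inverse_exists by blast
  then have "\<exists>c d. 1 = c * (w * h) + d * 0 \<and> 0 = c * 0 + d * 1"
    by (intro division_lemma[where p = 0 and q = 0 and M = "\<lambda>_ _. True"])
      (auto simp: coeff2_one)
  then show "h dvd 1" by (metis add_0_right dvd_triv_right mult.assoc mult_zero_right)
qed

text \<open>An element whose row 0 has least order in y generates \<open>I\<close> modulo
  \<open>X2\<close>; \<open>g\<close> guarantees that such an order exists. Saturation keeps the
  remainders in \<open>I\<close> after removal of \<open>X2\<close>. The ideal enters the division
  lemma as first component, with (0, 1) as second generator.\<close>

lemma saturated_ideal_principal:
  assumes lin: "\<And>g h c d. I g \<Longrightarrow> I h \<Longrightarrow> I (c * g + d * h)"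
    and sat: "\<And>h. I (X2 * h) \<Longrightarrow> I h"
    and g: "I g" "\<not> X2 dvd g"
  shows "\<exists>d. I d \<and> (\<forall>h. I h \<longrightarrow> d dvd h)"
proof -
  define P where "P n \<longleftrightarrow> (\<exists>h. I h \<and> coeff2 h 0 n \<noteq> 0)" for n
  have "\<exists>n. P n" using g by (auto simp: X2_dvd_iff P_def)
  then obtain p where p: "P p" "\<And>j. j < p \<Longrightarrow> \<not> P j"
    using LeastI_ex not_less_Least by metis
  obtain h where h: "I h" "coeff2 h 0 p \<noteq> 0" using p(1) by (auto simp: P_def)
  have low: "coeff2 k 0 j = 0" if "I k" "j < p" for k j using p(2) that by (auto simp: P_def)
  obtain w where w: "\<And>j. coeff2 (w * h) 0 j = (if j = p then 1 else 0)"
    using row_normalize[OF low[OF h(1)] h(2)] by blast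
  have d: "I (w * h)" using lin[OF h(1) h(1), of w 0] by simp
  have "w * h dvd k" if k: "I k" for k
  proof -
    have "\<exists>c d. k = c * (w * h) + d * 0 \<and> 0 = c * 0 + d * 1"
    proof (rule division_lemma[where p = p and q = 0 and M = "\<lambda>a _. I a"])
      fix a b c d a' b' assume "I a" "a - c * (w * h) - d * 0 = X2 * a'"
      then have "I (X2 * a')" using lin[of a "w * h" 1 "- c"] d by simp
      then show "I a'" by (rule sat)
    qed (use w low k in \<open>auto simp: coeff2_one\<close>)
    then show ?thesis by auto
  qed
  with d show ?thesis by blast
qed

text \<open>Echelon form over C{y}: \<open>p\<close> is the least order of a first component modulo
  \<open>X2\<close>, \<open>q\<close> the least order of a second component among pairs with first
  component 0 modulo \<open>X2\<close>. Only generation is claimed here; independence will come from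
  the determinant.\<close>

lemma saturated_submodule_free:
  fixes M :: "conv2 \<Rightarrow> conv2 \<Rightarrow> bool"
  assumes lin: "\<And>a b a' b' c d. M a b \<Longrightarrow> M a' b' \<Longrightarrow> M (c * a + d * a') (c * b + d * b')"
    and sat: "\<And>a b. M (X2 * a) (X2 * b) \<Longrightarrow> M a b"
    and g: "M g 0" "M 0 g" "\<not> X2 dvd g"
  shows "\<exists>a1 b1 a2 b2. M a1 b1 \<and> M a2 b2 \<and>
    (\<forall>a b. M a b \<longrightarrow> (\<exists>c d. a = c * a1 + d * a2 \<and> b = c * b1 + d * b2))"
proof -
  have sc: "M (c * a) (c * b)" if "M a b" for a b c using lin[OF that that, of c 0] by simp
  define P where "P n \<longleftrightarrow> (\<exists>a b. M a b \<and> coeff2 a 0 n \<noteq> 0)" for n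
  have "\<exists>n. P n" using g by (auto simp: X2_dvd_iff P_def)
  then obtain p where p: "P p" "\<And>j. j < p \<Longrightarrow> \<not> P j"
    using LeastI_ex not_less_Least by metis
  obtain a b where ab: "M a b" "coeff2 a 0 p \<noteq> 0" using p(1) by (auto simp: P_def)
  have lowp: "coeff2 a 0 j = 0" if "M a b" "j < p" for a b j using p(2) that by (auto simp: P_def)
  obtain w where w: "\<And>j. coeff2 (w * a) 0 j = (if j = p then 1 else 0)"
    using row_normalize[OF lowp[OF ab(1)] ab(2)] by blast
  define Q where "Q n \<longleftrightarrow> (\<exists>a b. M a b \<and> (\<forall>j. coeff2 a 0 j = 0) \<and> coeff2 b 0 n \<noteq> 0)" for n
  have "\<exists>n. Q n" using g(2,3) unfolding X2_dvd_iff Q_def by (metis coeff2_zero)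
  then obtain q where q: "Q q" "\<And>j. j < q \<Longrightarrow> \<not> Q j"
    using LeastI_ex not_less_Least by metis
  obtain a' b' where ab': "M a' b'" "\<And>j. coeff2 a' 0 j = 0" "coeff2 b' 0 q \<noteq> 0"
    using q(1) by (auto simp: Q_def)
  have lowq: "coeff2 b 0 j = 0" if "M a b" "\<And>j. coeff2 a 0 j = 0" "j < q" for a b j
    using q(2) that by (auto simp: Q_def)
  obtain v where v: "\<And>j. coeff2 (v * b') 0 j = (if j = q then 1 else 0)"
    using row_normalize[OF lowq[OF ab'(1,2)] ab'(3)] by blast
  have M1: "M (w * a) (w * b)" and M2: "M (v * a') (v * b')" using sc ab(1) ab'(1) by auto
  have "\<exists>c d. s = c * (w * a) + d * (v * a') \<and> t = c * (w * b) + d * (v * b')" if st: "M s t" for s t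
  proof -
    show "\<exists>c d. s = c * (w * a) + d * (v * a') \<and> t = c * (w * b) + d * (v * b')"
    proof (rule division_lemma[where p = p and q = q and M = M, OF w _ v])
      show "coeff2 (v * a') 0 j = 0" for j by (simp add: coeff2_mult_row0 ab'(2))
      show "M s t" by (rule st)
      show "coeff2 s 0 j = 0" if "M s t" "j < p" for s t j using lowp that .
      \<comment> \<open>Minimality of \<open>q\<close> concerns pairs with first component 0 modulo
        \<open>X2\<close>; subtracting a multiple of the first generator produces one.\<close>
      show "coeff2 (t - row_shift p s * (w * b)) 0 j = 0" if "M s t" "j < q" for s t j
      proof (rule lowq)
        show "M (s - row_shift p s * (w * a)) (t - row_shift p s * (w * b))"
          using lin[OF that(1) M1, of 1 "- row_shift p s"] by simp
        show "coeff2 (s - row_shift p s * (w * a)) 0 j = 0" for j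
          by (rule row_quotient_row0[OF w lowp[OF that(1)]])
      qed (rule that(2))
      fix s t c d s' t'
      assume *: "M s t" "s - c * (w * a) - d * (v * a') = X2 * s'"
        "t - c * (w * b) - d * (v * b') = X2 * t'"
      have "M (1 * (1 * s + (- c) * (w * a)) + (- d) * (v * a'))
              (1 * (1 * t + (- c) * (w * b)) + (- d) * (v * b'))"
        by (intro lin * M1 M2)
      then have "M (X2 * s') (X2 * t')" using *(2,3) by simp
      then show "M s' t'" by (rule sat)
    qed
  qed
  with M1 M2 show ?thesis by blast
qed


section \<open>Partial derivatives\<close>

lift_definition dx :: "conv2 \<Rightarrow> conv2" is formal_dx
proof -
  fix F :: formal2
  assume "convergent2 F"
  then obtain C R where F: "\<And>i j. norm (F $ i $ j) \<le> C * R ^ (i + j)" "R \<ge> 1" "C \<ge> 0"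
    by (rule convergent2E_bound) blast
  show "convergent2 (formal_dx F)"
  proof (rule convergent2I_bound[of _ "C * R" "2 * R"])
    fix i j
    have le: "real (Suc i) \<le> 2 ^ (i + j)"
    proof -
      have "real (Suc i) \<le> 2 ^ i"
        using less_exp[of i] by (metis Suc_leI of_nat_le_iff of_nat_numeral of_nat_power)
      also have "\<dots> \<le> 2 ^ (i + j)" by (intro power_increasing) auto
      finally show ?thesis .
    qed
    have "norm (formal_dx F $ i $ j) = real (Suc i) * norm (F $ Suc i $ j)"
      by (simp add: formal_dx_def fps_mult_of_nat_nth norm_mult del: of_nat_Suc)
    also have "\<dots> \<le> 2 ^ (i + j) * (C * R ^ (Suc i + j))"
      by (intro mult_mono le F) (use F in auto)
    finally show "norm (formal_dx F $ i $ j) \<le> C * R * (2 * R) ^ (i + j)"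
      by (simp add: power_mult_distrib mult_ac)
  qed
qed

lift_definition dy :: "conv2 \<Rightarrow> conv2" is formal_dy
proof -
  fix F :: formal2
  assume "convergent2 F"
  then obtain C R where F: "\<And>i j. norm (F $ i $ j) \<le> C * R ^ (i + j)" "R \<ge> 1" "C \<ge> 0"
    by (rule convergent2E_bound) blast
  show "convergent2 (formal_dy F)"
  proof (rule convergent2I_bound[of _ "C * R" "2 * R"])
    fix i j
    have le: "real (Suc j) \<le> 2 ^ (i + j)"
    proof -
      have "real (Suc j) \<le> 2 ^ j"
        using less_exp[of j] by (metis Suc_leI of_nat_le_iff of_nat_numeral of_nat_power)
      also have "\<dots> \<le> 2 ^ (i + j)" by (intro power_increasing) auto
      finally show ?thesis .
    qed
    have "norm (formal_dy F $ i $ j) = real (Suc j) * norm (F $ i $ Suc j)"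
      by (simp add: formal_dy_def norm_mult del: of_nat_Suc)
    also have "\<dots> \<le> 2 ^ (i + j) * (C * R ^ (i + Suc j))"
      by (intro mult_mono le F) (use F in auto)
    finally show "norm (formal_dy F $ i $ j) \<le> C * R * (2 * R) ^ (i + j)"
      by (simp add: power_mult_distrib mult_ac)
  qed
qed

lemma coeff2_dx: "coeff2 (dx h) i j = of_nat (Suc i) * coeff2 h (Suc i) j"
  by (simp add: coeff2_def dx.rep_eq formal_dx_def fps_mult_of_nat_nth del: of_nat_Suc)

lemma coeff2_dy: "coeff2 (dy h) i j = of_nat (Suc j) * coeff2 h i (Suc j)"
  by (simp add: coeff2_def dy.rep_eq formal_dy_def del: of_nat_Suc)

lemma dx_mult: "dx (g * h) = dx g * h + g * dx h"
  by transfer (rule formal_dx_mult)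

lemma dy_mult: "dy (g * h) = dy g * h + g * dy h"
  by transfer (rule formal_dy_mult)

lemma dx_add: "dx (g + h) = dx g + dx h" and dy_add: "dy (g + h) = dy g + dy h"
  by (rule conv2_eqI; simp add: coeff2_dx coeff2_dy algebra_simps)+

lemma dx_dy_commute: "dx (dy h) = dy (dx h)"
  by (rule conv2_eqI) (simp add: coeff2_dx coeff2_dy del: of_nat_Suc)

lemma dx_X [simp]: "dx X2 = 1" and dx_Y [simp]: "dx Y2 = 0"
  and dy_X [simp]: "dy X2 = 0" and dy_Y [simp]: "dy Y2 = 1"
  by (rule conv2_eqI; auto simp: coeff2_dx coeff2_dy coeff2_X coeff2_Y coeff2_one)+

definition vanishes :: "nat \<Rightarrow> conv2 \<Rightarrow> bool" where
  "vanishes n h \<longleftrightarrow> (\<forall>i j. i + j < n \<longrightarrow> coeff2 h i j = 0)"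

lemma vanishes_mult:
  assumes "vanishes m g" "vanishes n h"
  shows "vanishes (m + n) (g * h)"
  unfolding vanishes_def
proof (intro allI impI)
  fix i j assume ij: "i + j < m + n"
  have "coeff2 g k l * coeff2 h (i - k) (j - l) = 0" if "k \<le> i" "l \<le> j" for k l
  proof (cases "k + l < m")
    case False
    then have "(i - k) + (j - l) < n" using ij that by linarith
    then show ?thesis using assms(2) by (simp add: vanishes_def)
  qed (use assms(1) in \<open>simp add: vanishes_def\<close>)
  then show "coeff2 (g * h) i j = 0" unfolding coeff2_mult by (intro sum.neutral ballI) simp
qed

lemma vanishes_dvd:
  assumes "vanishes n g" "g dvd h"
  shows "vanishes n h"
proof -
  obtain k where "h = g * k" using assms(2) by blast
  moreover have "vanishes 0 k" by (simp add: vanishes_def)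
  ultimately show ?thesis using vanishes_mult[OF assms(1)] by force
qed

text \<open>Characteristic zero: if \<open>e\<close> has order n > 0, differentiating a lowest term
  shows that some partial derivative has order n - 1, too small for a multiple of
  \<open>e\<close>.\<close>

lemma unit_if_dvd_derivatives:
  assumes "e dvd dx e" "e dvd dy e" "e \<noteq> 0"
  shows "e dvd 1"
proof (rule ccontr)
  assume "\<not> e dvd 1"
  then have e0: "coeff2 e 0 0 = 0" by (simp add: conv2_unit_iff)
  define P where "P n \<longleftrightarrow> (\<exists>i j. i + j = n \<and> coeff2 e i j \<noteq> 0)" for n
  have "\<exists>n. P n" using assms(3) conv2_eqI[of e 0] by (auto simp: P_def)
  then obtain n where n: "P n" "\<And>m. m < n \<Longrightarrow> \<not> P m"
    using LeastI_ex not_less_Least by metis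
  have van: "vanishes n e" using n(2) by (auto simp: vanishes_def P_def)
  obtain i j where ij: "i + j = n" "coeff2 e i j \<noteq> 0" using n(1) by (auto simp: P_def)
  show False
  proof (cases i)
    case (Suc k)
    then have "coeff2 (dx e) k j = 0"
      using vanishes_dvd[OF van assms(1)] ij by (simp add: vanishes_def)
    then show False using ij Suc by (simp add: coeff2_dx del: of_nat_Suc)
  next
    case 0
    then obtain k where k: "j = Suc k" using e0 ij by (cases j) auto
    then have "coeff2 (dy e) i k = 0"
      using vanishes_dvd[OF van assms(2)] ij by (simp add: vanishes_def)
    then show False using ij k by (simp add: coeff2_dy del: of_nat_Suc)
  qed
qed


section \<open>Logarithmic vector fields of a reduced curve\<close>

lemma squarefree_nonzero: "squarefree (f :: conv2) \<Longrightarrow> f \<noteq> 0"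
proof
  assume "squarefree f" "f = 0"
  then have "X2 dvd 1" by (intro squarefreeD[of f]) auto
  then show False by (simp add: conv2_unit_iff coeff2_X)
qed

text \<open>Let \<open>d\<close> generate the ideal of all such \<open>h\<close>, and f = d * e.
  Then \<open>e\<close> divides d * dx e and d * dy e, and is prime to \<open>d\<close> by
  squarefreeness, so it divides its own derivatives and is a unit.\<close>

lemma squarefree_dvd_if_not_X2_dvd:
  assumes "squarefree f" and X: "\<not> X2 dvd f" and h: "f dvd h * dx f" "f dvd h * dy f"
  shows "f dvd h"
proof -
  define I where "I h \<longleftrightarrow> f dvd h * dx f \<and> f dvd h * dy f" for h
  have "\<exists>d. I d \<and> (\<forall>h. I h \<longrightarrow> d dvd h)"
  proof (rule saturated_ideal_principal[of I f])
    show "I (c * g + d * h)" if "I g" "I h" for g h c d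
    proof -
      have "f dvd c * (g * k) + d * (h * k)" if "f dvd g * k" "f dvd h * k" for k
        using that by simp
      from this[of "dx f"] this[of "dy f"] that show ?thesis by (simp add: I_def algebra_simps)
    qed
    show "I h" if "I (X2 * h)" for h
      using that unfolding I_def mult.assoc by (metis dvd_X2_mult_cancel[OF X])
  qed (simp_all add: I_def X)
  then obtain d where d: "I d" "\<And>h. I h \<Longrightarrow> d dvd h" by blast
  have "d dvd f" by (rule d(2)) (simp add: I_def)
  then obtain e where e: "f = d * e" by blast
  have nz: "d \<noteq> 0" "e \<noteq> 0" using e squarefree_nonzero[OF assms(1)] by auto
  \<comment> \<open>The ideal quotient (e : d). Its generator \<open>k\<close> is e / gcd(d, e) up
    to a unit, so the cofactor \<open>m\<close> is gcd(d, e), whose square divides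
    \<open>f\<close>.\<close>
  define J where "J h \<longleftrightarrow> e dvd d * h" for h
  have Xe: "\<not> X2 dvd e" using X e by auto
  have "\<exists>k. J k \<and> (\<forall>h. J h \<longrightarrow> k dvd h)"
  proof (rule saturated_ideal_principal[of J e])
    show "J (c * g + c' * h)" if "J g" "J h" for g h c c'
    proof -
      have "e dvd c * (d * g) + c' * (d * h)" using that by (auto simp: J_def)
      then show ?thesis by (simp add: J_def algebra_simps)
    qed
    show "J h" if "J (X2 * h)" for h
      using that dvd_X2_mult_cancel[OF Xe, of "d * h"] by (simp add: J_def mult_ac)
  qed (simp_all add: J_def Xe)
  then obtain k where k: "J k" "\<And>h. J h \<Longrightarrow> k dvd h" by blast
  have "k dvd e" by (rule k(2)) (simp add: J_def)
  then obtain m where m: "e = k * m" by blast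
  have "m dvd d" using k(1) nz unfolding J_def m by (auto simp: mult.commute[of d])
  then have "m\<^sup>2 dvd f" unfolding e m power2_eq_square
    by (metis dvd_mult dvd_triv_right mult_dvd_mono mult.commute dvd_refl)
  then have "m dvd 1" using assms(1) squarefreeD by blast
  \<comment> \<open>Cancel \<open>d\<close> and apply the Leibniz rule to f = d * e; the summands
    \<open>dx d * e\<close> and \<open>dy d * e\<close> drop out modulo \<open>e\<close>.\<close>
  have "d * e dvd d * dx f" "d * e dvd d * dy f" using d(1) e by (auto simp: I_def)
  then have "e dvd dx d * e + d * dx e" "e dvd dy d * e + d * dy e"
    using nz unfolding e by (simp_all add: dx_mult dy_mult)
  then have "J (dx e)" "J (dy e)" by (simp_all add: J_def dvd_add_right_iff)
  then have "e dvd dx e" "e dvd dy e"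
    using k(2) \<open>m dvd 1\<close> unfolding m by (metis mult_dvd_mono mult_1_right)+
  then have "e dvd 1" using nz unit_if_dvd_derivatives by blast
  then have "f dvd d" unfolding e by (metis mult_dvd_mono dvd_refl mult_1_right)
  also have "d dvd h" using h by (intro d(2)) (simp add: I_def)
  finally show ?thesis .
qed

lemma squarefree_X2_multD:
  assumes "squarefree (X2 * g)"
  shows "\<not> X2 dvd g" "squarefree g"
proof -
  show "\<not> X2 dvd g"
  proof
    assume "X2 dvd g"
    then have "X2\<^sup>2 dvd X2 * g" by (auto simp: power2_eq_square)
    then have "X2 dvd 1" using assms squarefreeD by blast
    then show False by (simp add: conv2_unit_iff coeff2_X)
  qed
  show "squarefree g" using assms by (meson dvd_triv_right squarefree_mono)
qed

text \<open>If f = X2 * g, then \<open>dx f\<close> is \<open>g\<close> modulo \<open>X2\<close>, so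
  the prime \<open>X2\<close> divides \<open>h\<close>; cancelling it leaves the same problem for
  \<open>g\<close>.\<close>

lemma squarefree_dvd_if_dvd_derivatives:
  assumes "squarefree f" and h: "f dvd h * dx f" "f dvd h * dy f"
  shows "f dvd h"
proof (cases "X2 dvd f")
  case True
  then obtain g where g: "f = X2 * g" by blast
  note sg = squarefree_X2_multD[OF assms(1)[unfolded g]]
  have cancel: "g dvd X2 * k \<longleftrightarrow> g dvd k" for k
    by (blast intro: dvd_mult dvd_X2_mult_cancel[OF sg(1), of k])
  have "X2 dvd h * dx f" using True h(1) by (rule dvd_trans)
  then have "X2 dvd h * g + X2 * (h * dx g)" by (simp add: g dx_mult algebra_simps)
  then have "X2 dvd h * g" by (metis dvd_add_left_iff dvd_triv_left)
  then have "X2 dvd h" using sg(1) by (simp add: X2_dvd_mult_iff)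
  then obtain k where k: "h = X2 * k" by blast
  have "X2 * g dvd X2 * (k * dx f)" "X2 * g dvd X2 * (X2 * (k * dy g))"
    using h by (simp_all add: g k dy_mult mult_ac)
  then have "g dvd k * dx f" "g dvd X2 * (k * dy g)" by simp_all
  then have "g dvd g * k + X2 * (k * dx g)" "g dvd k * dy g"
    using cancel by (simp_all add: g dx_mult algebra_simps)
  then have "g dvd k * dx g" "g dvd k * dy g"
    using cancel by (simp_all add: dvd_add_right_iff)
  then have "g dvd k" using squarefree_dvd_if_not_X2_dvd sg by blast
  then show ?thesis by (simp add: g k)
qed (use squarefree_dvd_if_not_X2_dvd assms in blast)

section \<open>Generators of the module of logarithmic fields\<close>

definition logarithmic :: "conv2 \<Rightarrow> conv2 \<Rightarrow> conv2 \<Rightarrow> bool" where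
  "logarithmic f a b \<longleftrightarrow> f dvd a * dx f + b * dy f"

lemma logarithmic_lin:
  assumes "logarithmic f a b" "logarithmic f a' b'"
  shows "logarithmic f (c * a + d * a') (c * b + d * b')"
proof -
  have "f dvd c * (a * dx f + b * dy f) + d * (a' * dx f + b' * dy f)"
    using assms by (auto simp: logarithmic_def)
  then show ?thesis by (simp add: logarithmic_def algebra_simps)
qed

text \<open>The field must be tangent to the line X2 = 0, which makes \<open>a\<close> a multiple of
  \<open>X2\<close>. What remains is a congruence modulo \<open>g\<close>, where \<open>X2\<close>
  can be cancelled: the saturated replacement for the logarithmic condition.\<close>

lemma logarithmic_X2_mult_iff:
  assumes "\<not> X2 dvd g"
  shows "logarithmic (X2 * g) a b \<longleftrightarrow> (\<exists>c. a = X2 * c \<and> g dvd c * (X2 * dx g) + b * dy g)"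
proof
  assume "logarithmic (X2 * g) a b"
  then have *: "X2 * g dvd a * g + X2 * (a * dx g + b * dy g)"
    by (simp add: logarithmic_def dx_mult dy_mult algebra_simps)
  then have "X2 dvd a * g + X2 * (a * dx g + b * dy g)" by (rule dvd_mult_left)
  then have "X2 dvd a * g" by (metis dvd_add_left_iff dvd_triv_left)
  then have "X2 dvd a" using assms by (simp add: X2_dvd_mult_iff)
  then obtain c where c: "a = X2 * c" by blast
  have "X2 * g dvd X2 * (g * c + (c * (X2 * dx g) + b * dy g))"
    using * by (simp add: c algebra_simps)
  then have "g dvd c * (X2 * dx g) + b * dy g" by (simp add: dvd_add_right_iff)
  with c show "\<exists>c. a = X2 * c \<and> g dvd c * (X2 * dx g) + b * dy g" by blast
next
  assume "\<exists>c. a = X2 * c \<and> g dvd c * (X2 * dx g) + b * dy g"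
  then obtain c where c: "a = X2 * c" "g dvd c * (X2 * dx g) + b * dy g" by blast
  then have "X2 * g dvd X2 * (g * c + (c * (X2 * dx g) + b * dy g))"
    by (intro mult_dvd_mono[OF dvd_refl] dvd_add[OF dvd_triv_left])
  then show "logarithmic (X2 * g) a b"
    by (simp add: logarithmic_def c dx_mult dy_mult algebra_simps)
qed

text \<open>Generation only; independence is derived in
  \<open>is_basis_vector_fields\<close>.\<close>

definition log_basis :: "conv2 \<Rightarrow> conv2 \<Rightarrow> conv2 \<Rightarrow> conv2 \<Rightarrow> conv2 \<Rightarrow> bool" where
  "log_basis f a1 b1 a2 b2 \<longleftrightarrow> logarithmic f a1 b1 \<and> logarithmic f a2 b2 \<and>
    (\<forall>a b. logarithmic f a b \<longrightarrow> (\<exists>c d. a = c * a1 + d * a2 \<and> b = c * b1 + d * b2))"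

text \<open>The module contains (g, 0) and (0, g) and is saturated. General \<open>u\<close> and
  \<open>v\<close> cover both \<open>dx f\<close>, \<open>dy f\<close> and the pair
  \<open>X2 * dx g\<close>, \<open>dy g\<close> for f = X2 * g.\<close>

lemma syzygies_free:
  assumes "\<not> X2 dvd g"
  shows "\<exists>a1 b1 a2 b2. g dvd a1 * u + b1 * v \<and> g dvd a2 * u + b2 * v \<and>
    (\<forall>a b. g dvd a * u + b * v \<longrightarrow> (\<exists>c d. a = c * a1 + d * a2 \<and> b = c * b1 + d * b2))"
proof (rule saturated_submodule_free[of "\<lambda>a b. g dvd a * u + b * v" g])
  show "g dvd (c * a + d * a') * u + (c * b + d * b') * v"
    if "g dvd a * u + b * v" "g dvd a' * u + b' * v" for a b a' b' c d
  proof -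
    have "g dvd c * (a * u + b * v) + d * (a' * u + b' * v)" using that by auto
    then show ?thesis by (simp add: algebra_simps)
  qed
  show "g dvd a * u + b * v" if "g dvd X2 * a * u + X2 * b * v" for a b
    by (rule dvd_X2_mult_cancel[OF assms]) (use that in \<open>simp add: algebra_simps\<close>)
qed (simp_all add: assms)

lemma log_basis_exists:
  assumes "squarefree f"
  shows "\<exists>a1 b1 a2 b2. log_basis f a1 b1 a2 b2"
proof (cases "X2 dvd f")
  case False
  show ?thesis
    unfolding log_basis_def logarithmic_def by (rule syzygies_free[OF False])
next
  case True
  then obtain g where g: "f = X2 * g" by blast
  note sg = squarefree_X2_multD[OF assms(1)[unfolded g]]
  obtain a1 b1 a2 b2 where *: "g dvd a1 * (X2 * dx g) + b1 * dy g" "g dvd a2 * (X2 * dx g) + b2 * dy g"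
    "\<And>a b. g dvd a * (X2 * dx g) + b * dy g \<Longrightarrow> \<exists>c d. a = c * a1 + d * a2 \<and> b = c * b1 + d * b2"
    using syzygies_free[OF sg(1), of "X2 * dx g" "dy g"] by blast
  have "\<exists>c d. a = c * (X2 * a1) + d * (X2 * a2) \<and> b = c * b1 + d * b2" if ab: "logarithmic f a b" for a b
  proof -
    obtain c where c: "a = X2 * c" "g dvd c * (X2 * dx g) + b * dy g"
      using ab logarithmic_X2_mult_iff[OF sg(1)] g by blast
    from *(3)[OF c(2)] c(1) show ?thesis by (force simp: algebra_simps)
  qed
  then have "log_basis f (X2 * a1) b1 (X2 * a2) b2"
    using * by (auto simp: log_basis_def g logarithmic_X2_mult_iff[OF sg(1)])
  then show ?thesis by blast
qed

text \<open>One half of Saito's criterion, by Cramer's rule.\<close>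

lemma squarefree_dvd_det:
  assumes "squarefree f" "logarithmic f a1 b1" "logarithmic f a2 b2"
  shows "f dvd a1 * b2 - a2 * b1"
proof (rule squarefree_dvd_if_dvd_derivatives[OF assms(1)])
  have "f dvd b2 * (a1 * dx f + b1 * dy f) - b1 * (a2 * dx f + b2 * dy f)"
    using assms(2,3) by (intro dvd_diff dvd_mult) (simp_all add: logarithmic_def)
  then show "f dvd (a1 * b2 - a2 * b1) * dx f" by (simp add: algebra_simps)
  have "f dvd a1 * (a2 * dx f + b2 * dy f) - a2 * (a1 * dx f + b1 * dy f)"
    using assms(2,3) by (intro dvd_diff dvd_mult) (simp_all add: logarithmic_def)
  then show "f dvd (a1 * b2 - a2 * b1) * dy f" by (simp add: algebra_simps)
qed

section \<open>The Tjurina ideal and singularity of logarithmic fields\<close>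

definition tjurina_ideal :: "conv2 \<Rightarrow> conv2 \<Rightarrow> bool" where
  "tjurina_ideal f h \<longleftrightarrow> (\<exists>u v w. h = u * f + v * dx f + w * dy f)"

lemma tjurina_ideal_lin:
  assumes "tjurina_ideal f g" "tjurina_ideal f h"
  shows "tjurina_ideal f (c * g + d * h)"
proof -
  obtain u v w u' v' w' where "g = u * f + v * dx f + w * dy f" "h = u' * f + v' * dx f + w' * dy f"
    using assms by (auto simp: tjurina_ideal_def)
  then have "c * g + d * h = (c * u + d * u') * f + (c * v + d * v') * dx f + (c * w + d * w') * dy f"
    by (simp add: algebra_simps)
  then show ?thesis unfolding tjurina_ideal_def by blast
qed

lemma tjurina_ideal_mult: "tjurina_ideal f h \<Longrightarrow> tjurina_ideal f (c * h)"
  using tjurina_ideal_lin[of f h h c 0] by simp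

lemma tjurina_ideal_gens: "tjurina_ideal f f" "tjurina_ideal f (dx f)" "tjurina_ideal f (dy f)"
proof -
  have "f = 1 * f + 0 * dx f + 0 * dy f" "dx f = 0 * f + 1 * dx f + 0 * dy f"
    "dy f = 0 * f + 0 * dx f + 1 * dy f" by simp_all
  then show "tjurina_ideal f f" "tjurina_ideal f (dx f)" "tjurina_ideal f (dy f)"
    unfolding tjurina_ideal_def by blast+
qed

text \<open>The commutator of the field with \<open>dx\<close> or \<open>dy\<close> is a combination
  of \<open>dx\<close> and \<open>dy\<close>, so it sends \<open>f\<close> into the ideal; hence the
  field sends \<open>dx f\<close> and \<open>dy f\<close> there too.\<close>

lemma tjurina_ideal_stable:
  assumes "logarithmic f a b" "tjurina_ideal f h"
  shows "tjurina_ideal f (a * dx h + b * dy h)"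
proof -
  obtain k where k: "a * dx f + b * dy f = f * k" using assms(1) by (auto simp: logarithmic_def)
  have "dx (a * dx f + b * dy f) = dx (f * k)" "dy (a * dx f + b * dy f) = dy (f * k)"
    by (simp_all add: k)
  then have kx: "a * dx (dx f) + b * dx (dy f) = dx f * k + f * dx k - dx a * dx f - dx b * dy f"
    and ky: "a * dx (dy f) + b * dy (dy f) = dy f * k + f * dy k - dy a * dx f - dy b * dy f"
    by (simp_all add: dx_add dy_add dx_mult dy_mult dx_dy_commute algebra_simps)
  obtain u v w where h: "h = u * f + v * dx f + w * dy f" using assms(2) by (auto simp: tjurina_ideal_def)
  have "a * dx h + b * dy h =
      (a * dx u + b * dy u) * f + (a * dx v + b * dy v) * dx f + (a * dx w + b * dy w) * dy f
      + u * (a * dx f + b * dy f) + v * (a * dx (dx f) + b * dx (dy f))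
      + w * (a * dx (dy f) + b * dy (dy f))"
    by (simp add: h dx_add dy_add dx_mult dy_mult dx_dy_commute algebra_simps)
  also have "\<dots> = (a * dx u + b * dy u + u * k + v * dx k + w * dy k) * f
      + (a * dx v + b * dy v + v * k - v * dx a - w * dy a) * dx f
      + (a * dx w + b * dy w - v * dx b + w * k - w * dy b) * dy f"
    unfolding k kx ky by (simp add: algebra_simps)
  finally show ?thesis unfolding tjurina_ideal_def by blast
qed

text \<open>The saturation \<open>I\<close> of the Tjurina ideal has a generator \<open>d\<close>, a
  common divisor of \<open>f\<close>, \<open>dx f\<close> and \<open>dy f\<close>. With f = d * k,
  both k * dx f and k * dy f lie in (f), so \<open>f\<close> divides \<open>k\<close> and
  \<open>d\<close> is a unit.\<close>

lemma tjurina_ideal_X2_power: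
  assumes "squarefree f" "\<not> X2 dvd f"
  shows "\<exists>n. tjurina_ideal f (X2 ^ n)"
proof -
  define I where "I h \<longleftrightarrow> (\<exists>n. tjurina_ideal f (X2 ^ n * h))" for h
  have g: "I f" "I (dx f)" "I (dy f)"
    unfolding I_def by (rule exI[of _ 0], simp add: tjurina_ideal_gens)+
  have "\<exists>d. I d \<and> (\<forall>h. I h \<longrightarrow> d dvd h)"
  proof (rule saturated_ideal_principal[of I f])
    show "I (c * g + d * h)" if gh: "I g" "I h" for g h c d
    proof -
      obtain m n where "tjurina_ideal f (X2 ^ m * g)" "tjurina_ideal f (X2 ^ n * h)"
        using gh by (auto simp: I_def)
      then have "tjurina_ideal f ((c * X2 ^ n) * (X2 ^ m * g) + (d * X2 ^ m) * (X2 ^ n * h))"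
        by (rule tjurina_ideal_lin)
      then have "tjurina_ideal f (X2 ^ (m + n) * (c * g + d * h))"
        by (simp add: power_add algebra_simps)
      then show ?thesis unfolding I_def by blast
    qed
    show "I h" if Xh: "I (X2 * h)" for h
    proof -
      obtain n where "tjurina_ideal f (X2 ^ n * (X2 * h))" using Xh unfolding I_def by blast
      then have "tjurina_ideal f (X2 ^ Suc n * h)" by (simp add: mult_ac)
      then show ?thesis unfolding I_def by blast
    qed
  qed (use g assms in auto)
  then obtain d where d: "I d" "\<And>h. I h \<Longrightarrow> d dvd h" by blast
  obtain k where k: "f = d * k" using d(2)[OF g(1)] by blast
  obtain r s where rs: "dx f = d * r" "dy f = d * s" using d(2)[OF g(2)] d(2)[OF g(3)] by blast
  have "k * dx f = f * r" "k * dy f = f * s" by (simp_all add: rs) (simp_all add: k mult_ac)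
  then have fk: "f dvd k" by (metis dvd_triv_left squarefree_dvd_if_dvd_derivatives[OF assms(1)])
  have "k \<noteq> 0" using k squarefree_nonzero[OF assms(1)] by auto
  obtain e where "k = f * e" using fk by blast
  then have "k * 1 = k * (d * e)" by (simp add: k mult_ac)
  then have e: "1 = d * e" using \<open>k \<noteq> 0\<close> mult_left_cancel by blast
  obtain n where "tjurina_ideal f (X2 ^ n * d)" using d(1) by (auto simp: I_def)
  then have "tjurina_ideal f (e * (X2 ^ n * d))" by (rule tjurina_ideal_mult)
  also have "e * (X2 ^ n * d) = X2 ^ n" using e by (simp add: mult_ac)
  finally show ?thesis by blast
qed

text \<open>Modulo \<open>X2\<close>, \<open>f\<close> is y^p times a unit, so y^p lies in the ideal
  (X2, f) and its n-th power in (X2^n, f).\<close>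

lemma tjurina_ideal_Y2_power:
  assumes "squarefree f" "\<not> X2 dvd f"
  shows "\<exists>n. tjurina_ideal f (Y2 ^ n)"
proof -
  obtain n where n: "tjurina_ideal f (X2 ^ n)" using tjurina_ideal_X2_power[OF assms] by blast
  have "\<exists>p. coeff2 f 0 p \<noteq> 0" using assms(2) by (auto simp: X2_dvd_iff)
  then obtain p where p: "coeff2 f 0 p \<noteq> 0" "\<And>j. j < p \<Longrightarrow> coeff2 f 0 j = 0"
    using exists_least_iff[of "\<lambda>p. coeff2 f 0 p \<noteq> 0"] by blast
  obtain w where w: "\<And>j. coeff2 (w * f) 0 j = (if j = p then 1 else 0)"
    using row_normalize[OF p(2) p(1)] by blast
  have Yp: "coeff2 (Y2 ^ p) 0 j = (if j = p then 1 else 0)" for p j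
    by (induction p arbitrary: j) (auto simp: coeff2_one coeff2_Y_mult split: nat.splits)
  have "X2 dvd Y2 ^ p - w * f" by (simp add: X2_dvd_iff w Yp)
  then obtain s where s: "Y2 ^ p = X2 * s + w * f" by (auto simp: algebra_simps elim: dvdE)
  have "\<exists>t. Y2 ^ (p * m) = X2 ^ m * s ^ m + t * f" for m
  proof (induction m)
    case (Suc m)
    then obtain t where t: "Y2 ^ (p * m) = X2 ^ m * s ^ m + t * f" by blast
    have "Y2 ^ (p * Suc m) = Y2 ^ p * Y2 ^ (p * m)" by (simp add: power_add)
    also have "\<dots> = (X2 * s + w * f) * (X2 ^ m * s ^ m + t * f)" by (simp only: s t)
    also have "\<dots> = X2 ^ Suc m * s ^ Suc m + (X2 * s * t + w * (X2 ^ m * s ^ m + t * f)) * f"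
      by (simp add: algebra_simps)
    finally show ?case by blast
  qed (auto intro: exI[of _ 0])
  then obtain t where "Y2 ^ (p * n) = s ^ n * X2 ^ n + t * f" by (auto simp: mult.commute)
  then show ?thesis using tjurina_ideal_lin[OF n tjurina_ideal_gens(1), of "s ^ n" t] by metis
qed

text \<open>
  A logarithmic field transversal to the origin would lower the exponents of the powers of \<open>X2\<close> and
  \<open>Y2\<close> in the Tjurina ideal down to \<open>0\<close>.
\<close>

lemma logarithmic_singular_if_not_X2_dvd:
  assumes "squarefree f" "\<not> X2 dvd f" "vanishes 2 f" "logarithmic f a b"
  shows "coeff2 a 0 0 = 0" "coeff2 b 0 0 = 0"
proof -
  have nt: "\<not> tjurina_ideal f 1"
  proof
    assume "tjurina_ideal f 1"
    then obtain u v w where "1 = u * f + v * dx f + w * dy f" by (auto simp: tjurina_ideal_def)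
    then have "coeff2 1 0 0 = coeff2 (u * f + v * dx f + w * dy f) 0 0" by simp
    then show False using assms(3) by (simp add: coeff2_one coeff2_dx coeff2_dy vanishes_def)
  qed
  \<comment> \<open>If \<open>c\<close> is a unit, the field sends z^(m+1) to (m+1) z^m c, which
    brings z^m into the ideal, and finally 1.\<close>
  have down: "\<not> c dvd 1" if n: "tjurina_ideal f (z ^ n)" and z: "a * dx z + b * dy z = c"
    for n z c
  proof
    assume "c dvd 1"
    then obtain e where e: "1 = c * e" by blast
    have dp: "dx (z ^ Suc m) = of_nat (Suc m) * z ^ m * dx z"
      "dy (z ^ Suc m) = of_nat (Suc m) * z ^ m * dy z" for m
    proof -
      show "dx (z ^ Suc m) = of_nat (Suc m) * z ^ m * dx z"
        by (induction m) (simp_all add: dx_mult algebra_simps)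
      show "dy (z ^ Suc m) = of_nat (Suc m) * z ^ m * dy z"
        by (induction m) (simp_all add: dy_mult algebra_simps)
    qed
    have "tjurina_ideal f 1" using n
    proof (induction n)
      case (Suc m)
      have "tjurina_ideal f (a * dx (z ^ Suc m) + b * dy (z ^ Suc m))"
        by (rule tjurina_ideal_stable[OF assms(4) Suc.prems])
      also have "a * dx (z ^ Suc m) + b * dy (z ^ Suc m) = of_nat (Suc m) * (z ^ m * c)"
        unfolding dp z[symmetric] by (simp add: algebra_simps del: of_nat_Suc)
      finally have "tjurina_ideal f (const2 (inverse (of_nat (Suc m))) * e * (of_nat (Suc m) * (z ^ m * c)))"
        by (rule tjurina_ideal_mult)
      moreover have "const2 (inverse (of_nat (Suc m))) * of_nat (Suc m) = (1 :: conv2)"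
      proof (rule conv2_eqI)
        have nc: "coeff2 (of_nat k) i j = (if i = 0 \<and> j = 0 then of_nat k else 0)" for k i j
          by (induction k) (auto simp: coeff2_one)
        show "coeff2 (const2 (inverse (of_nat (Suc m))) * of_nat (Suc m)) i j = coeff2 1 i j" for i j
          by (simp add: nc coeff2_one del: of_nat_Suc)
      qed
      then have "const2 (inverse (of_nat (Suc m))) * e * (of_nat (Suc m) * (z ^ m * c)) = z ^ m"
        using e by (metis mult.assoc mult.commute mult_1_left)
      ultimately have "tjurina_ideal f (z ^ m)" by (simp only:)
      then show ?case by (rule Suc.IH)
    qed simp
    then show False using nt by blast
  qed
  show "coeff2 a 0 0 = 0"
    using tjurina_ideal_X2_power[OF assms(1,2)] down[of X2 _ a] by (auto simp: conv2_unit_iff)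
  show "coeff2 b 0 0 = 0"
    using tjurina_ideal_Y2_power[OF assms(1,2)] down[of Y2 _ b] by (auto simp: conv2_unit_iff)
qed

text \<open>If f = X2 * g, the field is logarithmic for \<open>g\<close> as well, and
  \<open>g\<close> has order at least 2, as the other case demands.\<close>

lemma logarithmic_singular:
  assumes "squarefree f" "vanishes 3 f" "logarithmic f a b"
  shows "coeff2 a 0 0 = 0 \<and> coeff2 b 0 0 = 0"
proof (cases "X2 dvd f")
  case True
  then obtain g where g: "f = X2 * g" by blast
  note sg = squarefree_X2_multD[OF assms(1)[unfolded g]]
  obtain c where c: "a = X2 * c" "g dvd c * (X2 * dx g) + b * dy g"
    using assms(3) logarithmic_X2_mult_iff[OF sg(1)] g by blast
  have "vanishes 2 g"
    unfolding vanishes_def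
  proof (intro allI impI)
    fix i j :: nat assume "i + j < 2"
    then have "coeff2 f (Suc i) j = 0" using assms(2) by (simp add: vanishes_def)
    then show "coeff2 g i j = 0" by (simp add: g coeff2_X_mult)
  qed
  moreover have "logarithmic g a b" using c by (simp add: logarithmic_def mult_ac)
  ultimately show ?thesis using logarithmic_singular_if_not_X2_dvd[OF sg(2,1)] by blast
next
  case False
  have "vanishes 2 f" using assms(2) by (simp add: vanishes_def)
  then show ?thesis using logarithmic_singular_if_not_X2_dvd[OF assms(1) False _ assms(3)] by blast
qed

lemma ideal_power_max_ideal_vanishes:
  "h \<in> ideal_power max_ideal n \<Longrightarrow> vanishes n h"
proof (induction n arbitrary: h)
  case 0
  show ?case by (simp add: vanishes_def)
next
  case (Suc n)
  have "h \<in> module.span (*) {a * b | a b. a \<in> max_ideal \<and> b \<in> ideal_power max_ideal n}"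
    using Suc.prems by simp
  then show ?case
  proof (rule module.span_induct_alt[OF module_times])
    show "vanishes (Suc n) 0" by (simp add: vanishes_def)
    fix c x y
    assume "x \<in> {a * b | a b. a \<in> max_ideal \<and> b \<in> ideal_power max_ideal n}" and y: "vanishes (Suc n) y"
    then obtain a b where x: "x = a * b" "a \<in> max_ideal" "b \<in> ideal_power max_ideal n" by blast
    have "vanishes 1 a" using x(2) by (simp add: vanishes_def max_ideal_def)
    then have "vanishes (1 + n) x" unfolding x(1) by (rule vanishes_mult[OF _ Suc.IH[OF x(3)]])
    from vanishes_dvd[OF this, of "c * x"] have "vanishes (Suc n) (c * x)" by simp
    with y show "vanishes (Suc n) (c * x + y)" by (simp add: vanishes_def)
  qed
qed


section \<open>Topological nilpotence\<close>

definition formal_vanishes :: "nat \<Rightarrow> formal2 \<Rightarrow> bool" where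
  "formal_vanishes n F \<longleftrightarrow> (\<forall>i j. i + j < n \<longrightarrow> F $ i $ j = 0)"

lemma formal_vanishes_ideal_power:
  "formal_vanishes n F \<Longrightarrow> F \<in> ideal_power formal_max_ideal n"
proof (induction n arbitrary: F)
  case (Suc n)
  define A where "A = Abs_fps (\<lambda>i. F $ Suc i)"
  define B where "B = fps_const (Abs_fps (\<lambda>j. F $ 0 $ Suc j))"
  have F: "F = fps_X * A + fps_const fps_X * B"
  proof (intro fps_ext)
    fix i j
    show "F $ i $ j = (fps_X * A + fps_const fps_X * B) $ i $ j"
      using Suc.prems by (cases i; cases j) (simp_all add: A_def B_def formal_vanishes_def)
  qed
  have AB: "formal_vanishes n A" "formal_vanishes n B"
    using Suc.prems by (auto simp: formal_vanishes_def A_def B_def)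
  let ?S = "{a * b | a b. a \<in> formal_max_ideal \<and> b \<in> ideal_power formal_max_ideal n}"
  have X: "fps_X \<in> formal_max_ideal" "fps_const fps_X \<in> formal_max_ideal"
    by (simp_all add: formal_max_ideal_def)
  have "fps_X * A \<in> ?S" "fps_const fps_X * B \<in> ?S" using X Suc.IH AB by blast+
  then have "fps_X * A \<in> module.span (*) ?S" "fps_const fps_X * B \<in> module.span (*) ?S"
    by (blast intro: module.span_base[OF module_times])+
  then have "F \<in> module.span (*) ?S"
    unfolding F by (rule module.span_add[OF module_times])
  then show ?case by simp
qed simp

lemma formal_vanishes_mult:
  assumes "formal_vanishes m F" "formal_vanishes n G"
  shows "formal_vanishes (m + n) (F * G)"
  unfolding formal_vanishes_def
proof (intro allI impI)
  fix i j assume ij: "i + j < m + n"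
  have "F $ k $ l * G $ (i - k) $ (j - l) = 0" if "k \<le> i" "l \<le> j" for k l
  proof (cases "k + l < m")
    case False
    then have "(i - k) + (j - l) < n" using ij that by linarith
    then show ?thesis using assms(2) by (simp add: formal_vanishes_def)
  qed (use assms(1) in \<open>simp add: formal_vanishes_def\<close>)
  then show "(F * G) $ i $ j = 0" unfolding formal2_mult_nth by (intro sum.neutral ballI) simp
qed

text \<open>Differentiation lowers the order by at most one and the coefficients raise it by two, so
  each application gains one.\<close>

lemma topologically_nilpotent_if_vanishes:
  assumes "vanishes 2 (\<delta> X2)" "vanishes 2 (\<delta> Y2)"
  shows "topologically_nilpotent \<delta>"
proof -
  have v: "formal_vanishes 2 (to_formal (\<delta> X2))" "formal_vanishes 2 (to_formal (\<delta> Y2))"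
    using assms by (simp_all add: vanishes_def formal_vanishes_def coeff2_def)
  have step: "formal_vanishes (Suc n) (formal_extension \<delta> F)" if F: "formal_vanishes n F" for n F
  proof -
    \<comment> \<open>For \<open>n = 0\<close> the difference is truncated to 0, and the resulting
      order 2 is still at least \<open>Suc 0\<close>.\<close>
    have "formal_vanishes (n - 1) (formal_dx F)" "formal_vanishes (n - 1) (formal_dy F)"
      using F by (auto simp: formal_vanishes_def formal_dx_def formal_dy_def fps_mult_of_nat_nth
          simp del: of_nat_Suc of_nat_add)
    then have "formal_vanishes (2 + (n - 1)) (to_formal (\<delta> X2) * formal_dx F)"
      "formal_vanishes (2 + (n - 1)) (to_formal (\<delta> Y2) * formal_dy F)"
      using v formal_vanishes_mult by blast+
    then show ?thesis by (auto simp: formal_vanishes_def formal_extension_def)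
  qed
  have iter: "formal_vanishes m ((formal_extension \<delta> ^^ m) h)" for m h
    by (induction m) (simp_all add: step formal_vanishes_def[of 0])
  have "\<forall>\<^sub>F m in sequentially. (formal_extension \<delta> ^^ m) h \<in> ideal_power formal_max_ideal n" for h n
  proof (rule eventually_sequentiallyI[of n])
    fix m assume "n \<le> m"
    then have "formal_vanishes n ((formal_extension \<delta> ^^ m) h)"
      using iter[of m h] by (simp add: formal_vanishes_def)
    then show "(formal_extension \<delta> ^^ m) h \<in> ideal_power formal_max_ideal n"
      by (rule formal_vanishes_ideal_power)
  qed
  moreover have "singular \<delta>"
    using assms by (simp add: singular_def max_ideal_def vanishes_def)
  ultimately show ?thesis by (simp add: topologically_nilpotent_def)
qed


section \<open>Derivations as vector fields\<close>

definition vector_field :: "conv2 \<Rightarrow> conv2 \<Rightarrow> conv2 \<Rightarrow> conv2" where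
  "vector_field a b h = a * dx h + b * dy h"

lemma vector_field_XY [simp]: "vector_field a b X2 = a" "vector_field a b Y2 = b"
  by (simp_all add: vector_field_def)

lemma derivation_vector_field: "derivation (vector_field a b)"
proof -
  have c: "dx (const2 c) = 0" "dy (const2 c) = 0" for c
    by (rule conv2_eqI; simp add: coeff2_dx coeff2_dy coeff2_const)+
  show ?thesis
    by (simp add: derivation_def vector_field_def dx_add dy_add dx_mult dy_mult c algebra_simps)
qed

lemma derivation_eq_vector_field:
  assumes "derivation \<delta>"
  shows "\<delta> = vector_field (\<delta> X2) (\<delta> Y2)"
proof
  fix h
  have "to_formal (\<delta> h) = to_formal (vector_field (\<delta> X2) (\<delta> Y2) h)"
    using formal_extension_to_formal[OF assms, of h]
    by (simp add: formal_extension_def vector_field_def plus_conv2.rep_eq times_conv2.rep_eq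
        dx.rep_eq dy.rep_eq)
  then show "\<delta> h = vector_field (\<delta> X2) (\<delta> Y2) h" by (simp add: to_formal_inject)
qed

lemma Der_eq: "Der f = {vector_field a b | a b. logarithmic f a b}"
proof (intro set_eqI iffI)
  fix \<delta> assume "\<delta> \<in> Der f"
  then have *: "derivation \<delta>" "f dvd \<delta> f" by (simp_all add: Der_def)
  have d: "\<delta> = vector_field (\<delta> X2) (\<delta> Y2)" by (rule derivation_eq_vector_field[OF *(1)])
  have "logarithmic f (\<delta> X2) (\<delta> Y2)"
    using *(2) by (subst (asm) d) (simp add: logarithmic_def vector_field_def)
  then show "\<delta> \<in> {vector_field a b | a b. logarithmic f a b}" using d by blast
next
  fix \<delta> assume "\<delta> \<in> {vector_field a b | a b. logarithmic f a b}"
  then show "\<delta> \<in> Der f"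
    by (auto simp: Der_def derivation_vector_field) (simp add: logarithmic_def vector_field_def)
qed

text \<open>Expressing (f, 0) and (0, f) through the generators and taking determinants makes f^2 a
  multiple of this determinant.\<close>

lemma log_basis_det_nonzero:
  assumes "log_basis f a1 b1 a2 b2" "f \<noteq> 0"
  shows "a1 * b2 - a2 * b1 \<noteq> 0"
proof
  assume z: "a1 * b2 - a2 * b1 = 0"
  have "logarithmic f f 0" "logarithmic f 0 f" by (simp_all add: logarithmic_def)
  then obtain c d c' d' where cd: "f = c * a1 + d * a2" "0 = c * b1 + d * b2"
    and cd': "0 = c' * a1 + d' * a2" "f = c' * b1 + d' * b2"
    using assms(1) unfolding log_basis_def by meson
  have "f * f = f * f - 0 * 0" by simp
  also have "\<dots> = (c * a1 + d * a2) * (c' * b1 + d' * b2) - (c * b1 + d * b2) * (c' * a1 + d' * a2)"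
    using cd cd' by metis
  also have "\<dots> = (c * d' - d * c') * (a1 * b2 - a2 * b1)" by (simp add: algebra_simps)
  finally show False using assms(2) z by simp
qed

lemma is_basis_vector_fields:
  assumes "log_basis f a1 b1 a2 b2" "f \<noteq> 0"
  shows "vector_field a1 b1 \<noteq> vector_field a2 b2"
    and "is_basis {vector_field a1 b1, vector_field a2 b2} (Der f)"
proof -
  let ?v = "vector_field a1 b1" and ?w = "vector_field a2 b2"
  note det = log_basis_det_nonzero[OF assms]
  show ne: "?v \<noteq> ?w"
  proof
    assume eq: "?v = ?w"
    have "a1 = a2" "b1 = b2" using fun_cong[OF eq, of X2] fun_cong[OF eq, of Y2] by simp_all
    then show False using det by simp
  qed
  have comb: "scale_map c ?v + scale_map d ?w = vector_field (c * a1 + d * a2) (c * b1 + d * b2)"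
    for c d
    by (rule ext) (simp add: scale_map_def vector_field_def algebra_simps)
  have "\<not> module.dependent scale_map {?v, ?w}"
  proof
    assume "module.dependent scale_map {?v, ?w}"
    then obtain u where u: "u ?v \<noteq> 0 \<or> u ?w \<noteq> 0"
      "scale_map (u ?v) ?v + scale_map (u ?w) ?w = 0"
      using ne by (auto simp: module.dependent_finite[OF module_scale_map])
    define c d where "c = u ?v" and "d = u ?w"
    have z: "vector_field (c * a1 + d * a2) (c * b1 + d * b2) = 0"
      using u(2) by (simp add: comb c_def d_def)
    have *: "c * a1 + d * a2 = 0" "c * b1 + d * b2 = 0"
      using fun_cong[OF z, of X2] fun_cong[OF z, of Y2] by simp_all
    have "c * (a1 * b2 - a2 * b1) = b2 * (c * a1 + d * a2) - a2 * (c * b1 + d * b2)"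
      "d * (a1 * b2 - a2 * b1) = a1 * (c * b1 + d * b2) - b1 * (c * a1 + d * a2)"
      by (simp_all add: algebra_simps)
    then have "c = 0" "d = 0" unfolding * using det by simp_all
    then show False using u(1) by (auto simp: c_def d_def)
  qed
  moreover have "module.span scale_map {?v, ?w} = Der f"
  proof -
    have "module.span scale_map {?v, ?w} = range (\<lambda>u. scale_map (u ?v) ?v + scale_map (u ?w) ?w)"
      using ne by (simp add: module.span_finite[OF module_scale_map])
    also have "\<dots> = {vector_field (c * a1 + d * a2) (c * b1 + d * b2) | c d. True}"
    proof (intro set_eqI iffI)
      fix \<delta> assume "\<delta> \<in> {vector_field (c * a1 + d * a2) (c * b1 + d * b2) | c d. True}"
      then obtain c d where cd: "\<delta> = scale_map c ?v + scale_map d ?w" by (auto simp: comb)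
      show "\<delta> \<in> range (\<lambda>u. scale_map (u ?v) ?v + scale_map (u ?w) ?w)"
        by (rule range_eqI[of _ _ "\<lambda>x. if x = ?v then c else d"])
          (simp only: cd refl if_True ne[symmetric] if_False)
    qed (auto simp: comb)
    also have "\<dots> = Der f"
    proof -
      have "logarithmic f (c * a1 + d * a2) (c * b1 + d * b2)" for c d
        using assms(1) by (intro logarithmic_lin) (auto simp: log_basis_def)
      moreover have "\<exists>c d. vector_field a b = vector_field (c * a1 + d * a2) (c * b1 + d * b2)"
        if "logarithmic f a b" for a b
        using assms(1) that unfolding log_basis_def by metis
      ultimately show ?thesis unfolding Der_eq by blast
    qed
    finally show ?thesis .
  qed
  ultimately show "is_basis {?v, ?w} (Der f)" by (simp add: is_basis_def)
qed


section \<open>Linear changes of coordinates\<close>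

lemma const2_1 [simp]: "const2 1 = 1" and const2_0 [simp]: "const2 0 = 0"
  by (rule conv2_eqI; simp add: coeff2_const coeff2_one)+

lemma const2_power: "const2 c ^ n = const2 (c ^ n)"
  by (rule conv2_eqI, induction n) (auto simp: coeff2_const coeff2_one)

lemma of_nat_conv2: "(of_nat n :: conv2) = const2 (of_nat n)"
proof (rule conv2_eqI)
  show "coeff2 (of_nat n) i j = coeff2 (const2 (of_nat n)) i j" for i j
    by (induction n) (auto simp: coeff2_const coeff2_one)
qed

lemma coeff2_monomial: "coeff2 (X2 ^ a * Y2 ^ b) m n = (if a = m \<and> b = n then 1 else 0)"
proof (induction a arbitrary: m)
  case 0
  have "coeff2 (Y2 ^ b) m n = (if 0 = m \<and> b = n then 1 else 0)"
    by (induction b arbitrary: n) (auto simp: coeff2_one coeff2_Y_mult split: nat.splits)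
  then show ?case by simp
next
  case (Suc a)
  then show ?case by (auto simp: coeff2_X_mult mult.assoc split: nat.splits)
qed

lemma sum_sum_delta:
  fixes k :: "nat \<Rightarrow> nat \<Rightarrow> complex"
  assumes "m \<le> N" "n \<le> N"
  shows "(\<Sum>i\<le>N. \<Sum>j\<le>N. k i j * (if i = m \<and> j = n then 1 else 0)) = k m n"
proof -
  have "(\<Sum>i\<le>N. \<Sum>j\<le>N. k i j * (if i = m \<and> j = n then 1 else 0)) =
      (\<Sum>i\<le>N. \<Sum>j\<le>N. if j = n then if i = m then k m n else 0 else 0)"
    by (intro sum.cong) auto
  also have "\<dots> = k m n" using assms by simp
  finally show ?thesis .
qed

lemma expands_as_refl: "expands_as X2 Y2 h h"
  by (simp add: expands_as_def coeff2_monomial sum_sum_delta)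

lemma expands_as_swap:
  obtains k where "expands_as Y2 X2 h k" "\<And>i j. coeff2 k i j = coeff2 h j i"
proof -
  obtain C R where "\<And>i j. norm (coeff2 h i j) \<le> C * R ^ (i + j)" using coeff2_bound by metis
  then have "\<exists>k. \<forall>i j. coeff2 k i j = coeff2 h j i"
    by (intro conv2_of_coeffs[of _ C R]) (metis add.commute)
  then obtain k where k: "\<And>i j. coeff2 k i j = coeff2 h j i" by blast
  have "expands_as Y2 X2 h k"
    unfolding expands_as_def
  proof (intro allI)
    fix m n
    have "(\<Sum>i\<le>m+n. \<Sum>j\<le>m+n. coeff2 k i j * coeff2 (Y2 ^ i * X2 ^ j) m n) =
        (\<Sum>i\<le>m+n. \<Sum>j\<le>m+n. coeff2 k i j * (if i = n \<and> j = m then 1 else 0))"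
      by (intro sum.cong refl) (simp add: coeff2_monomial mult.commute[of "Y2 ^ _"])
    also have "\<dots> = coeff2 k n m" by (rule sum_sum_delta) auto
    finally show "coeff2 h m n = (\<Sum>i\<le>m+n. \<Sum>j\<le>m+n. coeff2 k i j * coeff2 (Y2 ^ i * X2 ^ j) m n)"
      by (simp add: k)
  qed
  with k show ?thesis using that by blast
qed

definition homogeneous :: "nat \<Rightarrow> conv2 \<Rightarrow> bool" where
  "homogeneous d h \<longleftrightarrow> (\<forall>i j. i + j \<noteq> d \<longrightarrow> coeff2 h i j = 0)"

lemma homogeneous_mult:
  assumes "homogeneous m g" "homogeneous n h"
  shows "homogeneous (m + n) (g * h)"
  unfolding homogeneous_def
proof (intro allI impI)
  fix i j assume ij: "i + j \<noteq> m + n"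
  have "coeff2 g k l * coeff2 h (i - k) (j - l) = 0" if "k \<le> i" "l \<le> j" for k l
  proof (cases "k + l = m")
    case True
    then have "(i - k) + (j - l) \<noteq> n" using ij that by linarith
    then show ?thesis using assms(2) by (simp add: homogeneous_def)
  qed (use assms(1) in \<open>simp add: homogeneous_def\<close>)
  then show "coeff2 (g * h) i j = 0" unfolding coeff2_mult by (intro sum.neutral ballI) simp
qed

lemma homogeneous_power: "homogeneous 1 h \<Longrightarrow> homogeneous n (h ^ n)"
proof (induction n)
  case (Suc n)
  then show ?case using homogeneous_mult[of 1 h n "h ^ n"] by simp
qed (simp add: homogeneous_def coeff2_one)

text \<open>The coefficients of \<open>k\<close> are those of \<open>h(x, y + t x)\<close>.\<close>

lemma expands_as_shear:
  obtains k where "expands_as X2 (Y2 - const2 t * X2) h k"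
    "coeff2 k 1 0 = coeff2 h 1 0 + t * coeff2 h 0 1" "coeff2 k 0 1 = coeff2 h 0 1"
proof -
  define w where "w = Y2 - const2 t * X2"
  \<comment> \<open>The monomial x^i y^j arises from x^(i-s) y^(j+s) by choosing t x in
    \<open>s\<close> of the j + s factors y + t x.\<close>
  define c where "c i j = (\<Sum>s\<le>i. coeff2 h (i - s) (j + s) * (of_nat ((j + s) choose s) * t ^ s))" for i j
  obtain C R where CR: "C \<ge> 0" "R \<ge> 1" "\<And>i j. norm (coeff2 h i j) \<le> C * R ^ (i + j)"
    using coeff2_bound[of h] by blast
  define T where "T = max 1 (norm t)"
  have T: "T \<ge> 1" "norm t \<le> T" by (simp_all add: T_def)
  \<comment> \<open>The 4 absorbs two powers of 2: one for the number of summands, one for the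
    binomial coefficients.\<close>
  have "norm (c i j) \<le> C * (4 * R * T) ^ (i + j)" for i j
  proof -
    have "norm (c i j) \<le> (\<Sum>s\<le>i. C * R ^ (i + j) * (2 ^ (i + j) * T ^ (i + j)))"
      unfolding c_def
    proof (intro sum_norm_le)
      fix s assume s: "s \<in> {..i}"
      have "real ((j + s) choose s) \<le> real (2 ^ (j + s))"
        using binomial_le_pow2 of_nat_le_iff by blast
      also have "\<dots> \<le> 2 ^ (i + j)" using s by simp
      finally have 1: "real ((j + s) choose s) \<le> 2 ^ (i + j)" .
      have "norm t ^ s \<le> T ^ s" by (intro power_mono T) simp
      also have "\<dots> \<le> T ^ (i + j)" using s T by (intro power_increasing) auto
      finally have 2: "norm t ^ s \<le> T ^ (i + j)" .
      have 3: "norm (coeff2 h (i - s) (j + s)) \<le> C * R ^ (i + j)"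
        using CR(3)[of "i - s" "j + s"] s by simp
      show "norm (coeff2 h (i - s) (j + s) * (of_nat ((j + s) choose s) * t ^ s)) \<le>
          C * R ^ (i + j) * (2 ^ (i + j) * T ^ (i + j))"
        unfolding norm_mult norm_power norm_of_nat
        by (intro mult_mono 1 2 3) (use CR T in auto)
    qed
    also have "\<dots> = real (Suc i) * (C * R ^ (i + j) * (2 ^ (i + j) * T ^ (i + j)))" by simp
    also have "\<dots> \<le> 2 ^ (i + j) * (C * R ^ (i + j) * (2 ^ (i + j) * T ^ (i + j)))"
    proof (rule mult_right_mono)
      have "real (Suc i) \<le> 2 ^ i"
        using less_exp[of i] by (metis Suc_leI of_nat_le_iff of_nat_numeral of_nat_power)
      also have "\<dots> \<le> 2 ^ (i + j)" by (intro power_increasing) auto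
      finally show "real (Suc i) \<le> 2 ^ (i + j)" .
    qed (use CR T in auto)
    also have "\<dots> = C * (2 * 2 * R * T) ^ (i + j)"
      by (simp only: power_mult_distrib mult_ac)
    finally show ?thesis by simp
  qed
  from conv2_of_coeffs[OF this] obtain k where k: "\<And>i j. coeff2 k i j = c i j" by blast
  have "coeff2 h m n = (\<Sum>i\<le>m+n. \<Sum>j\<le>m+n. coeff2 k i j * coeff2 (X2 ^ i * w ^ j) m n)" for m n
  proof -
    define N where "N = m + n"
    define e where "e i j = coeff2 (X2 ^ i * w ^ j) m n" for i j
    \<comment> \<open>Only pairs with i + j = N contribute, so the double sum collapses to a single
      one.\<close>
    have hom: "homogeneous (i + j) (X2 ^ i * w ^ j)" for i j
      by (intro homogeneous_mult homogeneous_power)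
        (auto simp: homogeneous_def w_def coeff2_X coeff2_Y)
    have e0: "e i j = 0" if "i + j \<noteq> N" for i j
      using hom[of i j] that by (simp add: homogeneous_def e_def N_def)
    have mono: "(if a = m \<and> b = n then 1 else 0) =
        (\<Sum>s\<le>b. of_nat (b choose s) * t ^ s * e (a + s) (b - s))" for a b
    proof -
      have "X2 ^ a * Y2 ^ b = X2 ^ a * (const2 t * X2 + w) ^ b" by (simp add: w_def)
      also have "\<dots> = (\<Sum>s\<le>b. const2 (of_nat (b choose s) * t ^ s) * (X2 ^ (a + s) * w ^ (b - s)))"
      proof -
        have cm: "const2 x * const2 y = const2 (x * y)" for x y
          by (rule conv2_eqI) (simp add: coeff2_const)
        show ?thesis
          unfolding binomial_ring sum_distrib_left
          by (intro sum.cong refl)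
            (simp add: cm[symmetric] const2_power[symmetric] of_nat_conv2[symmetric]
              power_mult_distrib power_add mult_ac)
      qed
      finally have "coeff2 (X2 ^ a * Y2 ^ b) m n =
          coeff2 (\<Sum>s\<le>b. const2 (of_nat (b choose s) * t ^ s) * (X2 ^ (a + s) * w ^ (b - s))) m n"
        by (rule arg_cong)
      then show ?thesis by (simp add: coeff2_monomial coeff2_sum e_def)
    qed
    have "coeff2 h m n = (\<Sum>a\<le>N. if a = m then coeff2 h m n else 0)"
      by (simp add: N_def)
    also have "\<dots> = (\<Sum>a\<le>N. coeff2 h a (N - a) * (if a = m \<and> N - a = n then 1 else 0))"
      by (intro sum.cong) (auto simp: N_def)
    also have "\<dots> = (\<Sum>a\<le>N. \<Sum>s\<le>N - a.
        coeff2 h a (N - a) * (of_nat ((N - a) choose s) * t ^ s * e (a + s) (N - a - s)))"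
      unfolding mono sum_distrib_left by simp
    also have "\<dots> = (\<Sum>(a, s)\<in>Sigma {..N} (\<lambda>a. {..N - a}).
        coeff2 h a (N - a) * (of_nat ((N - a) choose s) * t ^ s * e (a + s) (N - a - s)))"
      by (simp add: sum.Sigma)
    also have "\<dots> = (\<Sum>(i, s)\<in>Sigma {..N} (\<lambda>i. {..i}).
        coeff2 h (i - s) (N - i + s) * (of_nat ((N - i + s) choose s) * t ^ s) * e i (N - i))"
      by (rule sum.reindex_bij_witness[of _ "\<lambda>(i, s). (i - s, s)" "\<lambda>(a, s). (a + s, s)"])
        (auto simp: mult_ac)
    also have "\<dots> = (\<Sum>i\<le>N. c i (N - i) * e i (N - i))"
      by (simp add: sum.Sigma[symmetric] c_def sum_distrib_right)
    also have "\<dots> = (\<Sum>i\<le>N. \<Sum>j\<le>N. if j = N - i then c i j * e i j else 0)"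
      by (intro sum.cong) auto
    also have "\<dots> = (\<Sum>i\<le>N. \<Sum>j\<le>N. c i j * e i j)"
      by (intro sum.cong refl) (auto simp: e0)
    finally show ?thesis by (simp add: k e_def N_def)
  qed
  then have "expands_as X2 (Y2 - const2 t * X2) h k" by (simp add: expands_as_def w_def)
  moreover have "coeff2 k 1 0 = coeff2 h 1 0 + t * coeff2 h 0 1" "coeff2 k 0 1 = coeff2 h 0 1"
    by (simp_all add: k c_def)
  ultimately show ?thesis by (rule that)
qed


section \<open>Linear parts of a basis\<close>

lemma log_basis_change:
  fixes \<alpha> \<beta> \<gamma> \<epsilon> :: complex
  assumes "log_basis f a1 b1 a2 b2" "\<alpha> * \<epsilon> - \<beta> * \<gamma> \<noteq> 0"
  shows "log_basis f (const2 \<alpha> * a1 + const2 \<beta> * a2) (const2 \<alpha> * b1 + const2 \<beta> * b2)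
    (const2 \<gamma> * a1 + const2 \<epsilon> * a2) (const2 \<gamma> * b1 + const2 \<epsilon> * b2)"
proof -
  define A B G E D where "A = const2 \<alpha>" and "B = const2 \<beta>" and "G = const2 \<gamma>" and "E = const2 \<epsilon>"
    and "D = const2 (inverse (\<alpha> * \<epsilon> - \<beta> * \<gamma>))"
  have D: "D * (A * E - B * G) = 1"
  proof (rule conv2_eqI)
    show "coeff2 (D * (A * E - B * G)) i j = coeff2 1 i j" for i j
      using assms(2) by (simp add: A_def B_def G_def E_def D_def coeff2_const coeff2_one)
  qed
  have "\<exists>c d. a = c * (A * a1 + B * a2) + d * (G * a1 + E * a2) \<and>
      b = c * (A * b1 + B * b2) + d * (G * b1 + E * b2)" if "logarithmic f a b" for a b
  proof -
    obtain c d where cd: "a = c * a1 + d * a2" "b = c * b1 + d * b2"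
      using assms(1) \<open>logarithmic f a b\<close> unfolding log_basis_def by blast
    have *: "c * u + d * v = D * (c * E - d * G) * (A * u + B * v) + D * (d * A - c * B) * (G * u + E * v)"
      for u v
    proof -
      have "D * (c * E - d * G) * (A * u + B * v) + D * (d * A - c * B) * (G * u + E * v) =
          (D * (A * E - B * G)) * (c * u + d * v)"
        by (simp add: algebra_simps)
      then show ?thesis by (simp add: D)
    qed
    show ?thesis unfolding cd using * by blast
  qed
  then show ?thesis
    using assms(1) logarithmic_lin unfolding log_basis_def A_def B_def G_def E_def by blast
qed

text \<open>
  For every \<open>(x, y)\<close> the vectors \<open>(p\<^sub>i x + q\<^sub>i y, r\<^sub>i x + s\<^sub>i y)\<close>, \<open>i = 1, 2\<close>, are parallel. Then the two
  linear maps are dependent or have the same one-dimensional image.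
\<close>

lemma parallel_linear_maps:
  fixes p1 q1 r1 s1 p2 q2 r2 s2 :: complex
  assumes E1: "p1 * r2 = p2 * r1" and E2: "p1 * s2 + q1 * r2 = p2 * s1 + q2 * r1"
    and E3: "q1 * s2 = q2 * s1"
  shows "\<exists>\<alpha> \<beta> \<gamma> \<epsilon>. \<alpha> * \<epsilon> - \<beta> * \<gamma> \<noteq> 0 \<and>
    (\<alpha> * p1 + \<beta> * p2 = 0 \<and> \<alpha> * q1 + \<beta> * q2 = 0 \<and> \<alpha> * r1 + \<beta> * r2 = 0 \<and> \<alpha> * s1 + \<beta> * s2 = 0 \<or>
     \<alpha> * p1 + \<beta> * p2 = 0 \<and> \<alpha> * q1 + \<beta> * q2 = 0 \<and> \<alpha> * r1 + \<beta> * r2 = 0 \<and> \<alpha> * s1 + \<beta> * s2 = 1 \<and>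
     \<gamma> * p1 + \<epsilon> * p2 = 0 \<and> \<gamma> * q1 + \<epsilon> * q2 = 0 \<and> \<gamma> * r1 + \<epsilon> * r2 = 1 \<and> \<gamma> * s1 + \<epsilon> * s2 = 0 \<or>
     (\<exists>t. \<alpha> * p1 + \<beta> * p2 = 1 \<and> \<alpha> * q1 + \<beta> * q2 = 0 \<and> \<alpha> * r1 + \<beta> * r2 = t \<and> \<alpha> * s1 + \<beta> * s2 = 0 \<and>
     \<gamma> * p1 + \<epsilon> * p2 = - t \<and> \<gamma> * q1 + \<epsilon> * q2 = 1 \<and> \<gamma> * r1 + \<epsilon> * r2 = - t * t \<and> \<gamma> * s1 + \<epsilon> * s2 = t))"
proof -
  \<comment> \<open>Minors of the matrix with rows (p1, q1, r1, s1) and (p2, q2, r2, s2).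
    \<open>A\<close> and \<open>B\<close> test the independence of the two first and of the two
    second components. By \<open>E1\<close> and \<open>E3\<close> the pr and qs minors vanish; by
    \<open>E2\<close> the ps minor is \<open>u\<close>.\<close>
  define A where "A = p1 * q2 - p2 * q1"
  define B where "B = r1 * s2 - r2 * s1"
  define u where "u = q2 * r1 - q1 * r2"
  consider "A \<noteq> 0" | "A = 0" "B \<noteq> 0" | "A = 0" "B = 0" by blast
  then show ?thesis
  proof cases
    case 1
    define \<alpha> \<beta> where "\<alpha> = q2 / A" and "\<beta> = - q1 / A"
    define t where "t = u / A"
    \<comment> \<open>The first combination has first component x and second component t x, so the
      common image is the line y = t x. The coefficients \<open>- p2 / A\<close>,
      \<open>p1 / A\<close> alone would give first component y; subtracting \<open>t\<close> times
      the first combination turns it into y - t x, the coordinate vanishing on that line.\<close>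
    define \<gamma> \<epsilon> where "\<gamma> = - p2 / A - t * \<alpha>" and "\<epsilon> = p1 / A - t * \<beta>"
    have ab: "\<alpha> * p1 + \<beta> * p2 = 1" "\<alpha> * q1 + \<beta> * q2 = 0" "\<alpha> * r1 + \<beta> * r2 = t" "\<alpha> * s1 + \<beta> * s2 = 0"
    proof -
      have *: "\<alpha> * x + \<beta> * y = (q2 * x - q1 * y) / A" for x y
        by (simp add: \<alpha>_def \<beta>_def diff_divide_distrib)
      show "\<alpha> * p1 + \<beta> * p2 = 1" "\<alpha> * q1 + \<beta> * q2 = 0" "\<alpha> * r1 + \<beta> * r2 = t" "\<alpha> * s1 + \<beta> * s2 = 0"
        using 1 E3 unfolding * by (simp_all add: t_def u_def A_def mult_ac)
    qed
    have c0: "- p2 / A * p1 + p1 / A * p2 = 0" "- p2 / A * q1 + p1 / A * q2 = 1"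
      "- p2 / A * r1 + p1 / A * r2 = 0" "- p2 / A * s1 + p1 / A * s2 = t"
    proof -
      have "- p2 / A * q1 + p1 / A * q2 = (p1 * q2 - p2 * q1) / A" by (simp add: diff_divide_distrib)
      then show "- p2 / A * q1 + p1 / A * q2 = 1" using 1 by (simp add: A_def)
      have "- p2 * s1 + p1 * s2 = u" using E2 by (simp add: u_def algebra_simps)
      then show "- p2 / A * s1 + p1 / A * s2 = t" by (simp add: t_def diff_divide_distrib[symmetric])
    qed (simp_all add: E1)
    have ge: "\<gamma> * x + \<epsilon> * y = (- p2 / A * x + p1 / A * y) - t * (\<alpha> * x + \<beta> * y)" for x y
      by (simp add: \<gamma>_def \<epsilon>_def algebra_simps)
    have "\<alpha> * \<epsilon> - \<beta> * \<gamma> = (\<alpha> * p1 + \<beta> * p2) / A" by (simp add: \<gamma>_def \<epsilon>_def algebra_simps add_divide_distrib)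
    then have "\<alpha> * \<epsilon> - \<beta> * \<gamma> \<noteq> 0" using ab(1) 1 by simp
    then show ?thesis
      by (rule_tac exI[of _ \<alpha>], rule_tac exI[of _ \<beta>], rule_tac exI[of _ \<gamma>], rule_tac exI[of _ \<epsilon>])
        (unfold ge c0 ab, auto)
  next
    case 2
    have "u = p1 * s2 - p2 * s1" using E2 by (simp add: u_def algebra_simps)
    then have "u * u = (p1 * s2 - p2 * s1) * u" by simp
    \<comment> \<open>The Pluecker relation of the six minors.\<close>
    also have "\<dots> = A * B + (p1 * r2 - p2 * r1) * (q2 * s1 - q1 * s2)"
      by (simp add: u_def A_def B_def algebra_simps)
    also have "\<dots> = 0" using 2 E1 by simp
    finally have u: "u = 0" by simp
    then have u': "p1 * s2 = p2 * s1" "q2 * r1 = q1 * r2"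
      using E2 by (simp_all add: u_def algebra_simps)
    have *: "- r2 / B * x + r1 / B * y = (r1 * y - r2 * x) / B"
      "s2 / B * x + - s1 / B * y = (s2 * x - s1 * y) / B" for x y
      by (simp_all add: diff_divide_distrib)
    have **: "- r2 / B * (- s1 / B) - r1 / B * (s2 / B) = - B / (B * B)"
      by (simp add: B_def diff_divide_distrib mult.commute)
    show ?thesis
      by (rule exI[of _ "- r2 / B"], rule exI[of _ "r1 / B"], rule exI[of _ "s2 / B"], rule exI[of _ "- s1 / B"],
          unfold * **)
        (use 2 E1 E3 u' in \<open>simp add: B_def mult.commute\<close>)
  next
    case 3
    then have AB: "p1 * q2 = p2 * q1" "r1 * s2 = r2 * s1" by (simp_all add: A_def B_def)
    \<comment> \<open>Now all six minors vanish and the rows are dependent; the column of a nonzero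
      entry supplies the coefficients.\<close>
    have "\<exists>\<alpha> \<beta>. (\<alpha> \<noteq> 0 \<or> \<beta> \<noteq> 0) \<and> \<alpha> * p1 + \<beta> * p2 = 0 \<and> \<alpha> * q1 + \<beta> * q2 = 0 \<and>
        \<alpha> * r1 + \<beta> * r2 = 0 \<and> \<alpha> * s1 + \<beta> * s2 = 0"
    proof -
      consider "p1 \<noteq> 0" | "q1 \<noteq> 0" | "r1 \<noteq> 0" | "s1 \<noteq> 0" | "p1 = 0" "q1 = 0" "r1 = 0" "s1 = 0" by blast
      then show ?thesis
      proof cases
        case 1
        have "p1 * (p2 * s1 - p1 * s2) = 0" using E1 E2 AB by algebra
        then have "p2 * s1 = p1 * s2" using 1 by simp
        then show ?thesis
          by - (rule exI[of _ p2], rule exI[of _ "- p1"], use 1 E1 AB in \<open>simp add: algebra_simps\<close>)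
      next
        case 2
        have "q1 * (q2 * r1 - q1 * r2) = 0" using E2 E3 AB by algebra
        then have "q2 * r1 = q1 * r2" using 2 by simp
        then show ?thesis
          by - (rule exI[of _ q2], rule exI[of _ "- q1"], use 2 E3 AB in \<open>simp add: algebra_simps\<close>)
      next
        case 3
        have "r1 * (r2 * q1 - r1 * q2) = 0" using E1 E2 AB by algebra
        then have "r2 * q1 = r1 * q2" using 3 by simp
        then show ?thesis
          by - (rule exI[of _ r2], rule exI[of _ "- r1"], use 3 E1 AB in \<open>simp add: algebra_simps\<close>)
      next
        case 4
        have "s1 * (s2 * p1 - s1 * p2) = 0" using E2 E3 AB by algebra
        then have "s2 * p1 = s1 * p2" using 4 by simp
        then show ?thesis
          by - (rule exI[of _ s2], rule exI[of _ "- s1"], use 4 E3 AB in \<open>simp add: algebra_simps\<close>)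
      next
        case 5
        then show ?thesis by - (rule exI[of _ 1], rule exI[of _ 0], simp)
      qed
    qed
    then obtain \<alpha> \<beta> where ab: "\<alpha> \<noteq> 0 \<or> \<beta> \<noteq> 0" "\<alpha> * p1 + \<beta> * p2 = 0" "\<alpha> * q1 + \<beta> * q2 = 0"
      "\<alpha> * r1 + \<beta> * r2 = 0" "\<alpha> * s1 + \<beta> * s2 = 0" by blast
    \<comment> \<open>\<open>\<gamma>\<close> and \<open>\<epsilon>\<close> complete the row
      (\<open>\<alpha>\<close>, \<open>\<beta>\<close>) to an invertible matrix.\<close>
    then show ?thesis
      by - (rule exI[of _ \<alpha>], rule exI[of _ \<beta>], rule exI[of _ "if \<alpha> = 0 then 1 else 0"],
          rule exI[of _ "if \<alpha> = 0 then 0 else 1"], auto)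
  qed
qed

theorem propositionA1:
  fixes f :: conv2
  assumes "f \<in> ideal_power max_ideal 3" and "squarefree f"
  shows "\<exists>x y. local_coordinates x y \<and>
    (\<exists>\<delta>1 \<delta>2. \<delta>1 \<noteq> \<delta>2 \<and> is_basis {\<delta>1, \<delta>2} (Der f) \<and>
      ((\<exists>\<delta>\<in>{\<delta>1, \<delta>2}. has_linear_part x y \<delta> 0 0 \<and> topologically_nilpotent \<delta>) \<or>
       (\<exists>a. has_linear_part x y \<delta>1 x 0 \<and>
            has_linear_part x y \<delta>2 (const2 a * x + y) 0)))"
proof -
  have van: "vanishes 3 f" by (rule ideal_power_max_ideal_vanishes[OF assms(1)])
  have f0: "f \<noteq> 0" by (rule squarefree_nonzero[OF assms(2)])
  obtain a1 b1 a2 b2 where basis: "log_basis f a1 b1 a2 b2" using log_basis_exists[OF assms(2)] by blast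
  then have log: "logarithmic f a1 b1" "logarithmic f a2 b2" by (simp_all add: log_basis_def)
  have sing: "coeff2 a1 0 0 = 0" "coeff2 b1 0 0 = 0" "coeff2 a2 0 0 = 0" "coeff2 b2 0 0 = 0"
    using logarithmic_singular[OF assms(2) van] log by auto
  have "vanishes 3 (a1 * b2 - a2 * b1)"
    by (rule vanishes_dvd[OF van squarefree_dvd_det[OF assms(2) log]])
  then have "coeff2 (a1 * b2 - a2 * b1) 2 0 = 0" "coeff2 (a1 * b2 - a2 * b1) 1 1 = 0"
    "coeff2 (a1 * b2 - a2 * b1) 0 2 = 0"
    by (simp_all add: vanishes_def)
  \<comment> \<open>Without constant terms, the degree 2 part of the determinant is the determinant
    of the linear parts.\<close>
  then have
    "coeff2 a1 1 0 * coeff2 b2 1 0 = coeff2 a2 1 0 * coeff2 b1 1 0"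
    "coeff2 a1 1 0 * coeff2 b2 0 1 + coeff2 a1 0 1 * coeff2 b2 1 0 =
      coeff2 a2 1 0 * coeff2 b1 0 1 + coeff2 a2 0 1 * coeff2 b1 1 0"
    "coeff2 a1 0 1 * coeff2 b2 0 1 = coeff2 a2 0 1 * coeff2 b1 0 1"
    using sing by (simp_all add: coeff2_mult numeral_2_eq_2 algebra_simps)
  from parallel_linear_maps[OF this]
  obtain \<alpha> \<beta> \<gamma> \<epsilon> where det: "\<alpha> * \<epsilon> - \<beta> * \<gamma> \<noteq> 0" and lin:
    "\<alpha> * coeff2 a1 1 0 + \<beta> * coeff2 a2 1 0 = 0 \<and> \<alpha> * coeff2 a1 0 1 + \<beta> * coeff2 a2 0 1 = 0 \<and>
     \<alpha> * coeff2 b1 1 0 + \<beta> * coeff2 b2 1 0 = 0 \<and> \<alpha> * coeff2 b1 0 1 + \<beta> * coeff2 b2 0 1 = 0 \<or>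
     \<alpha> * coeff2 a1 1 0 + \<beta> * coeff2 a2 1 0 = 0 \<and> \<alpha> * coeff2 a1 0 1 + \<beta> * coeff2 a2 0 1 = 0 \<and>
     \<alpha> * coeff2 b1 1 0 + \<beta> * coeff2 b2 1 0 = 0 \<and> \<alpha> * coeff2 b1 0 1 + \<beta> * coeff2 b2 0 1 = 1 \<and>
     \<gamma> * coeff2 a1 1 0 + \<epsilon> * coeff2 a2 1 0 = 0 \<and> \<gamma> * coeff2 a1 0 1 + \<epsilon> * coeff2 a2 0 1 = 0 \<and>
     \<gamma> * coeff2 b1 1 0 + \<epsilon> * coeff2 b2 1 0 = 1 \<and> \<gamma> * coeff2 b1 0 1 + \<epsilon> * coeff2 b2 0 1 = 0 \<or>
     (\<exists>t. \<alpha> * coeff2 a1 1 0 + \<beta> * coeff2 a2 1 0 = 1 \<and> \<alpha> * coeff2 a1 0 1 + \<beta> * coeff2 a2 0 1 = 0 \<and>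
     \<alpha> * coeff2 b1 1 0 + \<beta> * coeff2 b2 1 0 = t \<and> \<alpha> * coeff2 b1 0 1 + \<beta> * coeff2 b2 0 1 = 0 \<and>
     \<gamma> * coeff2 a1 1 0 + \<epsilon> * coeff2 a2 1 0 = - t \<and> \<gamma> * coeff2 a1 0 1 + \<epsilon> * coeff2 a2 0 1 = 1 \<and>
     \<gamma> * coeff2 b1 1 0 + \<epsilon> * coeff2 b2 1 0 = - t * t \<and> \<gamma> * coeff2 b1 0 1 + \<epsilon> * coeff2 b2 0 1 = t)"
    by blast
  define c1 d1 c2 d2 where "c1 = const2 \<alpha> * a1 + const2 \<beta> * a2"
    and "d1 = const2 \<alpha> * b1 + const2 \<beta> * b2"
    and "c2 = const2 \<gamma> * a1 + const2 \<epsilon> * a2"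
    and "d2 = const2 \<gamma> * b1 + const2 \<epsilon> * b2"
  note defs = c1_def d1_def c2_def d2_def
  have basis': "log_basis f c1 d1 c2 d2"
    unfolding defs by (rule log_basis_change[OF basis det])
  note B = is_basis_vector_fields[OF basis' f0]
  let ?v = "vector_field c1 d1" and ?w = "vector_field c2 d2"
  have vf: "vector_field a b (g - const2 t * h) = vector_field a b g - const2 t * vector_field a b h"
    for a b g h t
    using derivation_vector_field[of a b] unfolding derivation_def
    by (metis add_diff_cancel_right' diff_add_cancel)
  consider "coeff2 c1 1 0 = 0" "coeff2 c1 0 1 = 0" "coeff2 d1 1 0 = 0" "coeff2 d1 0 1 = 0"
    | "coeff2 c1 1 0 = 0" "coeff2 c1 0 1 = 0" "coeff2 d1 1 0 = 0" "coeff2 d1 0 1 = 1"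
      "coeff2 c2 1 0 = 0" "coeff2 c2 0 1 = 0" "coeff2 d2 1 0 = 1" "coeff2 d2 0 1 = 0"
    | t where "coeff2 c1 1 0 = 1" "coeff2 c1 0 1 = 0" "coeff2 d1 1 0 = t" "coeff2 d1 0 1 = 0"
      "coeff2 c2 1 0 = - t" "coeff2 c2 0 1 = 1" "coeff2 d2 1 0 = - t * t" "coeff2 d2 0 1 = t"
    using lin by (auto simp: defs)
  then show ?thesis
  proof cases
    case 1
    have "vanishes 2 h" if "coeff2 h 0 0 = 0" "coeff2 h 1 0 = 0" "coeff2 h 0 1 = 0" for h
      unfolding vanishes_def
    proof (intro allI impI)
      fix i j :: nat assume "i + j < 2"
      then have "i = 0 \<and> j = 0 \<or> i = 1 \<and> j = 0 \<or> i = 0 \<and> j = 1" by linarith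
      then show "coeff2 h i j = 0" using that by auto
    qed
    then have "vanishes 2 c1" "vanishes 2 d1" using 1 sing by (simp_all add: defs)
    then have "topologically_nilpotent ?v" by (intro topologically_nilpotent_if_vanishes) simp_all
    moreover have "has_linear_part X2 Y2 ?v 0 0"
      unfolding has_linear_part_def
      by (rule exI[of _ c1], rule exI[of _ d1]) (simp add: expands_as_refl 1 del: One_nat_def)
    moreover have "local_coordinates X2 Y2"
      by (simp add: local_coordinates_def max_ideal_def coeff2_X coeff2_Y)
    ultimately show ?thesis using B by blast
  next
    case 2
    \<comment> \<open>Here the common image is the y-axis, so the coordinates are exchanged.\<close>
    have sw: "has_linear_part Y2 X2 (vector_field a b)
        (const2 (coeff2 b 0 1) * Y2 + const2 (coeff2 b 1 0) * X2)
        (const2 (coeff2 a 0 1) * Y2 + const2 (coeff2 a 1 0) * X2)" for a b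
    proof -
      obtain k where "expands_as Y2 X2 a k" "\<And>i j. coeff2 k i j = coeff2 a j i"
        using expands_as_swap by blast
      moreover obtain l where "expands_as Y2 X2 b l" "\<And>i j. coeff2 l i j = coeff2 b j i"
        using expands_as_swap by blast
      ultimately show ?thesis
        unfolding has_linear_part_def by - (rule exI[of _ l], rule exI[of _ k], simp)
    qed
    have "has_linear_part Y2 X2 ?v Y2 0" using sw[of c1 d1] by (simp add: 2 del: One_nat_def)
    moreover have "has_linear_part Y2 X2 ?w (const2 0 * Y2 + X2) 0"
      using sw[of c2 d2] by (simp add: 2 del: One_nat_def)
    moreover have "local_coordinates Y2 X2"
      by (simp add: local_coordinates_def max_ideal_def coeff2_X coeff2_Y)
    ultimately show ?thesis using B by blast
  next
    case 3
    \<comment> \<open>\<open>?y\<close> vanishes on the common image, so both fields send it to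
      something without linear part.\<close>
    let ?y = "Y2 - const2 t * X2"
    have sh: "has_linear_part X2 ?y (vector_field a b)
        (const2 (coeff2 a 1 0 + t * coeff2 a 0 1) * X2 + const2 (coeff2 a 0 1) * ?y) 0"
      if "coeff2 b 1 0 = t * coeff2 a 1 0" "coeff2 b 0 1 = t * coeff2 a 0 1" for a b
    proof -
      obtain k where k: "expands_as X2 ?y a k"
        "coeff2 k 1 0 = coeff2 a 1 0 + t * coeff2 a 0 1" "coeff2 k 0 1 = coeff2 a 0 1"
        by (rule expands_as_shear)
      obtain l where l: "expands_as X2 ?y (b - const2 t * a) l"
        "coeff2 l 1 0 = coeff2 (b - const2 t * a) 1 0 + t * coeff2 (b - const2 t * a) 0 1"
        "coeff2 l 0 1 = coeff2 (b - const2 t * a) 0 1"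
        by (rule expands_as_shear)
      show ?thesis
        unfolding has_linear_part_def
        by (rule exI[of _ k], rule exI[of _ l]) (use k l that in \<open>simp add: vf\<close>)
    qed
    have "has_linear_part X2 ?y ?v X2 0" using sh[of d1 c1] by (simp add: 3 del: One_nat_def)
    moreover have "has_linear_part X2 ?y ?w (const2 0 * X2 + ?y) 0"
      using sh[of d2 c2] by (simp add: 3 del: One_nat_def)
    moreover have "local_coordinates X2 ?y"
      by (simp add: local_coordinates_def max_ideal_def coeff2_X coeff2_Y)
    ultimately show ?thesis using B by blast
  qed
qed

end
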